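(* Let $A\in\mathbb{R}^{m\times n}$ be entrywise nonnegative with smallest nonzero entry equal to $1$, let $\|A\|_\infty=\max_{i,j}A_{ij}$, let $\epsilon\in(0,1/4]$, and let $\mathrm{OPT}$ be the optimal value of the packing LP $\max\{\langle\mathbf{1},x\rangle : Ax\le\mathbf{1},\ x\ge 0\}$. Run the algorithm PackingCoveringLP described in the context, and let $K$ be the iteration at which it terminates. Then its output $x^{(K)}$ satisfies $Ax^{(K)}\le(1+\epsilon)\mathbf{1}$ and $\langle\mathbf{1},x^{(K)}\rangle\ge(1-3\epsilon)\mathrm{OPT}$.
   Context: $\mathbf{1}$ is the all-ones vector, inequalities between vectors are entrywise, and $\log$ is the natural logarithm. Set $\alpha=\frac{\epsilon/4}{\log(mn\|A\|_\infty/\epsilon)}$ and $\eta=1/\epsilon$. For $x\ge0$ let $f_\alpha(x)=-\langle\mathbf{1},x\rangle+\frac{\alpha}{1+\alpha}\sum_{i=1}^m (Ax)_i^{(1+\alpha)/\alpha}$, so that $\nabla_j f_\alpha(x)=-1+\sum_{i}A_{ij}(Ax)_i^{1/\alpha}\ge -1$. The truncated gradient $T(x)\in\mathbb{R}^n$ is defined by $T_j(x)=\nabla_j f_\alpha(x)$ if $\nabla_j f_\alpha(x)\le 1$ and $T_j(x)=1$ otherwise. Let $\psi(x)=\eta\big(-\langle\mathbf{1},x\rangle+\sum_{j=1}^n \frac{x_j^{1-\alpha}}{1-\alpha}\big)$ for $x\ge0$. Algorithm PackingCoveringLP: set $x^{(0)}=\frac{1-\epsilon}{n\|A\|_\infty}\mathbf{1}$,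 $z^{(0)}=\nabla\psi(x^{(0)})$, $A_0=1$, $k=0$, and $\gamma=\alpha^2\eta/4$. While $A_k\le\eta$: increase $k$ by one; set $x^{(k)}_j=(1+z^{(k-1)}_j/\eta)^{-1/\alpha}$ for all $j$; set $z^{(k)}=z^{(k-1)}+\gamma\,T(x^{(k)})$; set $A_k=A_{k-1}+\gamma$. When the loop ends (at $k=K$, the first index with $A_K>\eta$), output $x^{(K)}$. *)

theory Defs
  imports "HOL-Analysis.Analysis"
begin

text \<open>
  Throughout, \<open>A\<close> has \<open>CARD('m)\<close> rows and \<open>CARD('n)\<close> columns, \<open>1\<close> of type \<open>real ^ 'n\<close> is the
  all-ones vector, and \<open>\<le>\<close> on vectors is the entrywise order.
\<close>

definition packing_feasible :: "real ^ 'n ^ 'm \<Rightarrow> real ^ 'n \<Rightarrow> bool" where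
  "packing_feasible A x \<longleftrightarrow> 0 \<le> x \<and> A *v x \<le> 1"

text \<open>The maximum has to be attained; in particular no \<open>v\<close> qualifies if the LP is unbounded, which
  happens when \<open>A\<close> has a zero column.\<close>

definition is_packing_opt :: "real ^ 'n ^ 'm \<Rightarrow> real \<Rightarrow> bool" where
  "is_packing_opt A v \<longleftrightarrow>
     (\<exists>x. packing_feasible A x \<and> 1 \<bullet> x = v) \<and> (\<forall>x. packing_feasible A x \<longrightarrow> 1 \<bullet> x \<le> v)"

definition max_entry :: "real ^ 'n ^ 'm \<Rightarrow> real" where
  "max_entry A = Max (range (\<lambda>(i, j). A $ i $ j))"

definition alpha :: "real ^ 'n ^ 'm \<Rightarrow> real \<Rightarrow> real" where
  "alpha A \<epsilon> = (\<epsilon> / 4) / ln (real CARD('m) * real CARD('n) * max_entry A / \<epsilon>)"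

definition eta :: "real \<Rightarrow> real" where
  "eta \<epsilon> = 1 / \<epsilon>"

definition gamma :: "real ^ 'n ^ 'm \<Rightarrow> real \<Rightarrow> real" where
  "gamma A \<epsilon> = (alpha A \<epsilon>)\<^sup>2 * eta \<epsilon> / 4"

text \<open>Two-sided derivative on the whole space. The functions below are meant on the nonnegative
  orthant, and \<open>gradient\<close> is only informative for them in its interior, where all iterates of the
  algorithm lie.\<close>

definition gradient :: "('a::real_inner \<Rightarrow> real) \<Rightarrow> 'a \<Rightarrow> 'a" where
  "gradient f x = (THE D. GDERIV f x :> D)"

definition f_alpha :: "real ^ 'n ^ 'm \<Rightarrow> real \<Rightarrow> real ^ 'n \<Rightarrow> real" where
  "f_alpha A \<alpha> x =
     - (1 \<bullet> x) + \<alpha> / (1 + \<alpha>) * (\<Sum>i\<in>UNIV. (A *v x) $ i powr ((1 + \<alpha>) / \<alpha>))"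

definition trunc_gradient :: "real ^ 'n ^ 'm \<Rightarrow> real \<Rightarrow> real ^ 'n \<Rightarrow> real ^ 'n" where
  "trunc_gradient A \<alpha> x =
     (\<chi> j. if gradient (f_alpha A \<alpha>) x $ j \<le> 1 then gradient (f_alpha A \<alpha>) x $ j else 1)"

definition psi :: "real \<Rightarrow> real \<Rightarrow> real ^ 'n \<Rightarrow> real" where
  "psi \<alpha> \<eta> x = \<eta> * (- (1 \<bullet> x) + (\<Sum>j\<in>UNIV. x $ j powr (1 - \<alpha>) / (1 - \<alpha>)))"

definition x_init :: "real ^ 'n ^ 'm \<Rightarrow> real \<Rightarrow> real ^ 'n" where
  "x_init A \<epsilon> = ((1 - \<epsilon>) / (real CARD('n) * max_entry A)) *\<^sub>R 1"

definition x_of_z :: "real \<Rightarrow> real \<Rightarrow> real ^ 'n \<Rightarrow> real ^ 'n" where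
  "x_of_z \<alpha> \<eta> z = (\<chi> j. (1 + z $ j / \<eta>) powr (- 1 / \<alpha>))"

text \<open>The sequences run on past termination of the loop; only the iterates up to \<open>stop_iter\<close> are
  computed by the algorithm.\<close>

primrec z_iter :: "real ^ 'n ^ 'm \<Rightarrow> real \<Rightarrow> nat \<Rightarrow> real ^ 'n" where
  "z_iter A \<epsilon> 0 = gradient (psi (alpha A \<epsilon>) (eta \<epsilon>)) (x_init A \<epsilon>)"
| "z_iter A \<epsilon> (Suc k) = z_iter A \<epsilon> k +
     gamma A \<epsilon> *\<^sub>R trunc_gradient A (alpha A \<epsilon>) (x_of_z (alpha A \<epsilon>) (eta \<epsilon>) (z_iter A \<epsilon> k))"

primrec x_iter :: "real ^ 'n ^ 'm \<Rightarrow> real \<Rightarrow> nat \<Rightarrow> real ^ 'n" where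
  "x_iter A \<epsilon> 0 = x_init A \<epsilon>"
| "x_iter A \<epsilon> (Suc k) = x_of_z (alpha A \<epsilon>) (eta \<epsilon>) (z_iter A \<epsilon> k)"

primrec A_iter :: "real ^ 'n ^ 'm \<Rightarrow> real \<Rightarrow> nat \<Rightarrow> real" where
  "A_iter A \<epsilon> 0 = 1"
| "A_iter A \<epsilon> (Suc k) = A_iter A \<epsilon> k + gamma A \<epsilon>"

definition stop_iter :: "real ^ 'n ^ 'm \<Rightarrow> real \<Rightarrow> nat" where
  "stop_iter A \<epsilon> = (LEAST k. A_iter A \<epsilon> k > eta \<epsilon>)"

definition packing_covering_lp :: "real ^ 'n ^ 'm \<Rightarrow> real \<Rightarrow> real ^ 'n" where
  "packing_covering_lp A \<epsilon> = x_iter A \<epsilon> (stop_iter A \<epsilon>)"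

lemma gradient_eqI:
  assumes "GDERIV f x :> D"
  shows "gradient f x = D"
  unfolding gradient_def
proof (rule the_equality)
  fix D' assume "GDERIV f x :> D'"
  then have "(\<lambda>h. h \<bullet> D') = (\<lambda>h. h \<bullet> D)"
    using assms has_derivative_unique unfolding gderiv_def by blast
  then have "(D' - D) \<bullet> D' = (D' - D) \<bullet> D"
    by metis
  then show "D' = D"
    by (metis inner_diff_right inner_eq_zero_iff right_minus_eq diff_self)
qed (fact assms)

lemma gradient_f_alpha:
  fixes A :: "real ^ 'n ^ 'm"
  assumes A: "\<And>i j. A $ i $ j \<ge> 0" and x: "\<And>j. x $ j > 0" and \<alpha>: "\<alpha> > 0"
  shows "gradient (f_alpha A \<alpha>) x = (\<chi> j. - 1 + (\<Sum>i\<in>UNIV. A $ i $ j * (A *v x) $ i powr (1 / \<alpha>)))"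
proof (rule gradient_eqI)
  have row: "((\<lambda>y. (A *v y) $ i powr ((1 + \<alpha>) / \<alpha>)) has_derivative
      (\<lambda>h. (1 + \<alpha>) / \<alpha> * (A *v x) $ i powr (1 / \<alpha>) * (A *v h) $ i)) (at x)" for i
  proof (cases "\<forall>j. A $ i $ j = 0")
    case True
    then show ?thesis by (simp add: matrix_vector_mult_def)
  next
    case False
    then obtain j where "A $ i $ j \<noteq> 0" by blast
    then have "A $ i $ j * x $ j > 0"
      using A[of i j] x[of j] by simp
    then have pos: "(A *v x) $ i > 0"
      using A x sum_pos2[of UNIV j "\<lambda>j. A $ i $ j * x $ j"]
      by (simp add: matrix_vector_mult_def less_imp_le)
    have lin: "((\<lambda>y. (A *v y) $ i) has_derivative (\<lambda>h. (A *v h) $ i)) (at x)"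
      unfolding matrix_vector_mult_def vec_lambda_beta
      by (intro has_derivative_sum has_derivative_mult_right
          bounded_linear_imp_has_derivative[OF bounded_linear_vec_nth])
    have "((\<lambda>t::real. t powr ((1 + \<alpha>) / \<alpha>)) has_real_derivative
        (1 + \<alpha>) / \<alpha> * (A *v x) $ i powr ((1 + \<alpha>) / \<alpha> - 1)) (at ((A *v x) $ i))"
      using pos by (rule has_real_derivative_powr)
    moreover have "(1 + \<alpha>) / \<alpha> - 1 = 1 / \<alpha>"
      using \<alpha> by (simp add: field_simps)
    ultimately have "((\<lambda>t::real. t powr ((1 + \<alpha>) / \<alpha>)) has_derivative
        (*) ((1 + \<alpha>) / \<alpha> * (A *v x) $ i powr (1 / \<alpha>))) (at ((A *v x) $ i))"
      by (simp add: has_field_derivative_def)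
    from has_derivative_compose[OF lin this] show ?thesis .
  qed
  have "(f_alpha A \<alpha> has_derivative (\<lambda>h. - (1 \<bullet> h) +
      \<alpha> / (1 + \<alpha>) * (\<Sum>i\<in>UNIV. (1 + \<alpha>) / \<alpha> * (A *v x) $ i powr (1 / \<alpha>) * (A *v h) $ i))) (at x)"
    unfolding f_alpha_def[abs_def] by (intro has_derivative_add has_derivative_minus
        has_derivative_inner_right has_derivative_ident has_derivative_mult_right has_derivative_sum row)
  moreover have "- (1 \<bullet> h) +
      \<alpha> / (1 + \<alpha>) * (\<Sum>i\<in>UNIV. (1 + \<alpha>) / \<alpha> * (A *v x) $ i powr (1 / \<alpha>) * (A *v h) $ i) =
      h \<bullet> (\<chi> j. - 1 + (\<Sum>i\<in>UNIV. A $ i $ j * (A *v x) $ i powr (1 / \<alpha>)))" for h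
  proof -
    have "\<alpha> / (1 + \<alpha>) * (\<Sum>i\<in>UNIV. (1 + \<alpha>) / \<alpha> * (A *v x) $ i powr (1 / \<alpha>) * (A *v h) $ i) =
        (\<Sum>i\<in>UNIV. (A *v x) $ i powr (1 / \<alpha>) * (A *v h) $ i)"
      unfolding sum_distrib_left using \<alpha> by (intro sum.cong) auto
    also have "\<dots> = (\<Sum>i\<in>UNIV. \<Sum>j\<in>UNIV. h $ j * (A $ i $ j * (A *v x) $ i powr (1 / \<alpha>)))"
      by (simp add: matrix_vector_mult_def[of A h] sum_distrib_left mult_ac)
    also have "\<dots> = (\<Sum>j\<in>UNIV. \<Sum>i\<in>UNIV. h $ j * (A $ i $ j * (A *v x) $ i powr (1 / \<alpha>)))"
      by (rule sum.swap)
    finally show ?thesis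
      by (simp add: inner_vec_def distrib_left sum.distrib sum_negf sum_distrib_left sum_subtractf
          right_diff_distrib)
  qed
  ultimately show "GDERIV (f_alpha A \<alpha>) x :> (\<chi> j. - 1 + (\<Sum>i\<in>UNIV. A $ i $ j * (A *v x) $ i powr (1 / \<alpha>)))"
    unfolding gderiv_def by simp
qed

lemma gradient_psi:
  fixes x :: "real ^ 'n"
  assumes x: "\<And>j. x $ j > 0" and \<alpha>: "\<alpha> \<noteq> 1"
  shows "gradient (psi \<alpha> \<eta>) x = (\<chi> j. \<eta> * (- 1 + x $ j powr (- \<alpha>)))"
proof (rule gradient_eqI)
  have coord: "((\<lambda>y. y $ j powr (1 - \<alpha>) / (1 - \<alpha>)) has_derivative (\<lambda>h. x $ j powr (- \<alpha>) * h $ j)) (at x)" for j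
  proof -
    have lin: "((\<lambda>y::real^'n. y $ j) has_derivative (\<lambda>h. h $ j)) (at x)"
      by (rule bounded_linear_imp_has_derivative[OF bounded_linear_vec_nth])
    have "((\<lambda>t::real. t powr (1 - \<alpha>) / (1 - \<alpha>)) has_real_derivative
        ((1 - \<alpha>) * x $ j powr (1 - \<alpha> - 1)) / (1 - \<alpha>)) (at (x $ j))"
      by (intro DERIV_cdivide has_real_derivative_powr x)
    then have "((\<lambda>t::real. t powr (1 - \<alpha>) / (1 - \<alpha>)) has_derivative
        (*) (x $ j powr (- \<alpha>))) (at (x $ j))"
      using \<alpha> by (simp add: has_field_derivative_def)
    from has_derivative_compose[OF lin this] show ?thesis .
  qed
  have "(psi \<alpha> \<eta> has_derivative
      (\<lambda>h. \<eta> * (- (1 \<bullet> h) + (\<Sum>j\<in>UNIV. x $ j powr (- \<alpha>) * h $ j)))) (at x)"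
    unfolding psi_def[abs_def] by (intro has_derivative_add has_derivative_minus
        has_derivative_inner_right has_derivative_ident has_derivative_mult_right has_derivative_sum coord)
  moreover have "\<eta> * (- (1 \<bullet> h) + (\<Sum>j\<in>UNIV. x $ j powr (- \<alpha>) * h $ j)) =
      h \<bullet> (\<chi> j. \<eta> * (- 1 + x $ j powr (- \<alpha>)))" for h
    by (simp add: inner_vec_def algebra_simps sum_distrib_left sum_subtractf)
  ultimately show "GDERIV (psi \<alpha> \<eta>) x :> (\<chi> j. \<eta> * (- 1 + x $ j powr (- \<alpha>)))"
    unfolding gderiv_def by simp
qed

lemma z_iter_Suc_x_iter:
  "z_iter A \<epsilon> (Suc k) =
     z_iter A \<epsilon> k + gamma A \<epsilon> *\<^sub>R trunc_gradient A (alpha A \<epsilon>) (x_iter A \<epsilon> (Suc k))"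
  by simp

lemma A_iter_eq: "A_iter A \<epsilon> k = 1 + real k * gamma A \<epsilon>"
  by (induction k) (auto simp: algebra_simps)

lemma stop_iter_properties:
  assumes "\<epsilon> > 0" and "alpha A \<epsilon> \<noteq> 0"
  shows "A_iter A \<epsilon> (stop_iter A \<epsilon>) > eta \<epsilon>"
    and "k < stop_iter A \<epsilon> \<Longrightarrow> A_iter A \<epsilon> k \<le> eta \<epsilon>"
proof -
  have "gamma A \<epsilon> > 0"
    using assms by (simp add: gamma_def eta_def)
  then obtain k where "eta \<epsilon> < real k * gamma A \<epsilon>"
    using reals_Archimedean3 by blast
  then have "A_iter A \<epsilon> k > eta \<epsilon>"
    by (simp add: A_iter_eq)
  then show "A_iter A \<epsilon> (stop_iter A \<epsilon>) > eta \<epsilon>"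
    unfolding stop_iter_def by (rule LeastI)
  show "A_iter A \<epsilon> k \<le> eta \<epsilon>" if "k < stop_iter A \<epsilon>" for k
    using that not_less_Least unfolding stop_iter_def by fastforce
qed

end

(*
The algorithm is mirror descent on f_alpha with mirror map -psi, and its output is read off the
weighted sums A_k f_alpha(x^(k+1)). Convexity and the three-point identity bound the regret of x
against a feasible u by D(x, x') + gamma <grad f - T, x>, where D is the Bregman divergence, x' the
next iterate, and the second term is the cost of truncation. Since gamma / eta = alpha^2 / 4, every
coordinate moves by a factor within 1 +- O(alpha), so (Ax)^(1/alpha) changes by at most a constant
factor and f_alpha is locally smooth: the decrease f(x) - f(x') pays for both terms already with
weight A_0 = 1. Hence
A_k f(x^(k+1)) + D(u, x^(k+1)) <= f(x^(0)) + D(u, x^(0)) + (A_k - 1) f(u).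
For u = (1 - eps/4) x* and A_k close to eta = 1/eps, D(u, x^(0)) <= (3/5) OPT gives the guarantee.
Approximate feasibility is an invariant: a row above 1 has only positive partial derivatives on its
support, so it cannot grow.
*)
theory Submission
  imports Defs
begin

section \<open>Scalar inequalities\<close>

lemma exp_le_quadratic:
  fixes x :: real
  assumes "\<bar>x\<bar> \<le> 1"
  shows "exp x \<le> 1 + x + x\<^sup>2"
proof (cases "0 \<le> x")
  case True
  then show ?thesis
    using exp_bound[of x] assms by simp
next
  case False
  define t where "t = - x"
  have t: "0 < t" "t \<le> 1"
    using False assms by (auto simp: t_def)
  \<comment> \<open>The right-hand side is \<open>1 + t ^ 3\<close>; together with
    \<open>1 + t \<le> exp t\<close> this bounds the reciprocal of \<open>exp t\<close>.\<close>
  have "1 \<le> (1 - t + t\<^sup>2) * (1 + t)"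
    using t by (simp add: algebra_simps power2_eq_square)
  also have "\<dots> \<le> (1 - t + t\<^sup>2) * exp t"
    using t by (intro mult_left_mono) auto
  finally have "exp (- t) \<le> 1 - t + t\<^sup>2"
    by (simp add: exp_minus divide_simps)
  then show ?thesis
    by (simp add: t_def)
qed

lemma Youngs_inequality_powr:
  fixes u x a :: real
  assumes "0 \<le> u" "0 < x" "0 < a" "a < 1"
  shows "u powr (1 - a) * x powr a \<le> (1 - a) * u + a * x"
proof (cases "u = 0")
  case True
  then show ?thesis using assms by simp
next
  case False
  then show ?thesis
    using Youngs_inequality_0[of "1 - a" a u x] assms by simp
qed

text \<open>Convexity of \<open>u powr q / q\<close>: its graph lies above the tangent at
  \<open>s\<close>. For positive arguments this is Young's inequality with weights
  \<open>1 / q\<close> and \<open>1 - 1 / q\<close>.\<close>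

lemma powr_tangent_le:
  fixes s u q :: real
  assumes "0 \<le> s" "0 \<le> u" "1 < q" and "s = 0 \<Longrightarrow> u = 0"
  shows "s powr q / q + s powr (q - 1) * (u - s) \<le> u powr q / q"
proof (cases "s = 0 \<or> u = 0")
  case True
  have "s powr (q - 1) * s = s powr q"
    using assms by (cases "s = 0") (simp_all add: powr_diff)
  moreover have "1 * s powr q \<le> q * s powr q"
    using assms by (intro mult_right_mono) auto
  ultimately show ?thesis
    using True assms by (auto simp: field_simps)
next
  case False
  then have pos: "0 < s" "0 < u"
    using assms by auto
  have "u * s powr (q - 1) = (u powr q) powr (1 / q) * (s powr q) powr (1 - 1 / q)"
    using assms pos by (simp add: powr_powr algebra_simps)
  also have "\<dots> \<le> 1 / q * u powr q + (1 - 1 / q) * s powr q"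
    using assms pos by (intro Youngs_inequality_0) auto
  finally have "s powr (q - 1) * u \<le> u powr q / q + s powr q - s powr q / q"
    by (simp add: algebra_simps)
  moreover have "s powr (q - 1) * s = s powr q"
    using pos by (simp add: powr_diff)
  ultimately show ?thesis
    unfolding right_diff_distrib by linarith
qed

text \<open>With \<open>p = 1 / \<alpha>\<close>, the bound on \<open>r\<close> says
  \<open>\<bar>p * r\<bar> \<le> 1\<close>, so \<open>(1 + r) powr p \<le> exp (p * r)\<close> is at
  most quadratic in \<open>p * r\<close>. This controls the penalty of one row whose value
  \<open>s\<close> changes by the relative amount \<open>r\<close>.\<close>

lemma powr_second_order_le:
  fixes s r \<alpha> :: real
  assumes s: "0 \<le> s" and \<alpha>: "0 < \<alpha>" "\<alpha> < 1" and r: "\<bar>r\<bar> \<le> \<alpha>"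
  shows "\<alpha> / (1 + \<alpha>) * (s * (1 + r)) powr ((1 + \<alpha>) / \<alpha>) \<le>
    \<alpha> / (1 + \<alpha>) * s powr ((1 + \<alpha>) / \<alpha>) + s powr (1 / \<alpha>) * (s * r) +
    (1 + \<bar>r\<bar>) / \<alpha> * (s powr (1 / \<alpha>) * (s * r\<^sup>2))"
proof -
  define p where "p = 1 / \<alpha>"
  have p: "1 < p" and ap: "\<alpha> * p = 1"
    using \<alpha> by (auto simp: p_def)
  have q: "(1 + \<alpha>) / \<alpha> = 1 + p" "\<alpha> / (1 + \<alpha>) = 1 / (1 + p)"
    using \<alpha> by (auto simp: p_def field_simps)
  have pr: "\<bar>p * r\<bar> \<le> 1"
    using r \<alpha> by (simp add: p_def abs_mult)
  have r1: "0 < 1 + r"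
    using r \<alpha> by linarith
  have "(1 + r) powr p \<le> exp (p * r)"
    using p r1 ln_add_one_self_le_self2[of r] by (simp add: powr_def)
  also have "\<dots> \<le> 1 + p * r + (p * r)\<^sup>2"
    by (rule exp_le_quadratic[OF pr])
  finally have "(1 + r) powr (1 + p) \<le> (1 + r) * (1 + p * r + (p * r)\<^sup>2)"
    using r1 by (simp add: powr_add)
  also have "\<dots> = 1 + (1 + p) * (r + p * r\<^sup>2) + p\<^sup>2 * r\<^sup>2 * r"
    by (simp add: algebra_simps power2_eq_square)
  \<comment> \<open>The cubic term goes into the factor \<open>1 + \<bar>r\<bar>\<close> of the
    quadratic one: enlarging one of its factors \<open>p\<close> to \<open>1 + p\<close> makes it a
    multiple of \<open>1 + p\<close>.\<close>
  also have "p\<^sup>2 * r\<^sup>2 * r \<le> p\<^sup>2 * r\<^sup>2 * \<bar>r\<bar>"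
    by (intro mult_left_mono) auto
  also have "p\<^sup>2 * r\<^sup>2 * \<bar>r\<bar> = p * (p * r\<^sup>2 * \<bar>r\<bar>)"
    by (simp add: power2_eq_square)
  also have "\<dots> \<le> (1 + p) * (p * r\<^sup>2 * \<bar>r\<bar>)"
    using p by (intro mult_right_mono) auto
  finally have "(1 + r) powr (1 + p) \<le> 1 + (1 + p) * (r + (1 + \<bar>r\<bar>) * (p * r\<^sup>2))"
    by (simp add: algebra_simps)
  then have "1 / (1 + p) * (1 + r) powr (1 + p) \<le> 1 / (1 + p) * (1 + (1 + p) * (r + (1 + \<bar>r\<bar>) * (p * r\<^sup>2)))"
    using p by (intro mult_left_mono) auto
  also have "\<dots> = 1 / (1 + p) + r + (1 + \<bar>r\<bar>) * (p * r\<^sup>2)"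
    using p by (simp add: distrib_left[of "1 / (1 + p)"] add_divide_distrib)
  finally have main: "1 / (1 + p) * (1 + r) powr (1 + p) \<le> 1 / (1 + p) + r + (1 + \<bar>r\<bar>) * (p * r\<^sup>2)" .
  have sp: "s powr (1 + p) = s powr p * s"
    using s by (cases "s = 0") (simp_all add: powr_add)
  have "1 / (1 + p) * (s * (1 + r)) powr (1 + p) = s powr (1 + p) * (1 / (1 + p) * (1 + r) powr (1 + p))"
    using s r1 by (simp add: powr_mult)
  also have "\<dots> \<le> s powr (1 + p) * (1 / (1 + p) + r + (1 + \<bar>r\<bar>) * (p * r\<^sup>2))"
    using main by (intro mult_left_mono) auto
  also have "\<dots> = 1 / (1 + p) * s powr (1 + p) + s powr p * (s * r) + (1 + \<bar>r\<bar>) * p * (s powr p * (s * r\<^sup>2))"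
    unfolding distrib_left by (simp add: sp algebra_simps)
  finally show ?thesis
    unfolding q by (simp add: p_def)
qed

section \<open>The Bregman divergence\<close>

text \<open>One coordinate of the Bregman divergence of \<open>- psi \<alpha> 1\<close>.\<close>

definition breg :: "real \<Rightarrow> real \<Rightarrow> real \<Rightarrow> real" where
  "breg \<alpha> u x = u * x powr (- \<alpha>) - u powr (1 - \<alpha>) / (1 - \<alpha>) + \<alpha> / (1 - \<alpha>) * x powr (1 - \<alpha>)"

text \<open>Young's inequality for \<open>u powr (1 - \<alpha>) * x powr \<alpha>\<close>,
  multiplied by \<open>x powr (- \<alpha>)\<close>; the divergence is the gap between its two sides,
  divided by \<open>1 - \<alpha>\<close>.\<close>

lemma breg_nonneg:
  assumes "0 \<le> u" "0 < x" "0 < \<alpha>" "\<alpha> < 1"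
  shows "0 \<le> breg \<alpha> u x"
proof -
  have "u powr (1 - \<alpha>) = (u powr (1 - \<alpha>) * x powr \<alpha>) * x powr (- \<alpha>)"
    using assms by (simp add: mult.assoc flip: powr_add)
  also have "\<dots> \<le> ((1 - \<alpha>) * u + \<alpha> * x) * x powr (- \<alpha>)"
    using assms by (intro mult_right_mono Youngs_inequality_powr) auto
  also have "\<dots> = (1 - \<alpha>) * (u * x powr (- \<alpha>)) + \<alpha> * x powr (1 - \<alpha>)"
    using assms powr_add[of x 1 "- \<alpha>"] by (simp add: algebra_simps)
  finally have "u powr (1 - \<alpha>) \<le> (1 - \<alpha>) * (u * x powr (- \<alpha>)) + \<alpha> * x powr (1 - \<alpha>)" .
  moreover have "breg \<alpha> u x =
      ((1 - \<alpha>) * (u * x powr (- \<alpha>)) + \<alpha> * x powr (1 - \<alpha>) - u powr (1 - \<alpha>)) / (1 - \<alpha>)"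
    using assms by (simp add: breg_def add_divide_distrib diff_divide_distrib)
  ultimately show ?thesis
    using assms by simp
qed

text \<open>The last factor is the change of the mirror variable \<open>x powr (- \<alpha>)\<close>,
  which in the algorithm is a multiple of the truncated gradient. Regret against \<open>u\<close>
  thus becomes a telescoping difference of divergences plus the cost
  \<open>breg \<alpha> x y\<close> of the step.\<close>

lemma breg_three_point:
  assumes "0 < x" "0 < y" "0 < \<alpha>" "\<alpha> < 1"
  shows "breg \<alpha> u x - breg \<alpha> u y + breg \<alpha> x y = (x - u) * (y powr (- \<alpha>) - x powr (- \<alpha>))"
proof -
  define c where "c = 1 / (1 - \<alpha>)"
  have *: "x powr (1 - \<alpha>) = x * x powr (- \<alpha>)" "y powr (1 - \<alpha>) = y * y powr (- \<alpha>)"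
    using assms by (simp_all add: powr_diff powr_minus_divide)
  have c: "\<alpha> / (1 - \<alpha>) = c - 1" "v / (1 - \<alpha>) = v * c" for v
    using assms by (simp_all add: c_def field_simps)
  show ?thesis
    unfolding breg_def * unfolding c(1) unfolding c(2) by (simp add: algebra_simps)
qed

lemma breg_self:
  assumes "0 < x" "\<alpha> < 1"
  shows "breg \<alpha> x x = 0"
  using breg_three_point[of x x \<alpha> x] assms
  unfolding breg_def by (simp add: powr_diff powr_minus_divide) (simp add: field_simps)

text \<open>The three-point identity at \<open>u = y\<close> evaluates the symmetrized divergence;
  its nonnegative summand \<open>breg \<alpha> y x\<close> is dropped.\<close>

lemma breg_le_symmetric:
  assumes "0 < x" "0 < y" "0 < \<alpha>" "\<alpha> < 1"
  shows "breg \<alpha> x y \<le> (x - y) * (y powr (- \<alpha>) - x powr (- \<alpha>))"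
  using breg_three_point[of x y \<alpha> y] breg_nonneg[of y x \<alpha>] breg_self[of y \<alpha>] assms
  by simp

section \<open>One mirror step in one coordinate\<close>

text \<open>Factoring out \<open>x powr (- \<alpha>)\<close> gives
  \<open>y = x * (1 + \<alpha> * b) powr (- 1 / \<alpha>)\<close>, so \<open>- b\<close> is the
  relative change to first order. The upper and the lower bound for \<open>ln (1 + a)\<close> with
  \<open>a = \<alpha> * b\<close> limit the error on either side.\<close>

lemma mirror_step_bounds:
  fixes x \<alpha> T :: real
  defines "y \<equiv> (x powr (- \<alpha>) + \<alpha>\<^sup>2 / 4 * T) powr (- 1 / \<alpha>)"
    and "b \<equiv> \<alpha> / 4 * T * x powr \<alpha>"
  assumes x: "0 < x" "x powr \<alpha> \<le> 101 / 100" and \<alpha>: "0 < \<alpha>" "\<alpha> \<le> 1 / 16" and T: "\<bar>T\<bar> \<le> 1"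
  obtains \<theta> where "y = x * (1 + \<theta>)" "- b \<le> \<theta>" "\<theta> \<le> - b + 6 / 5 * b\<^sup>2" "\<bar>b\<bar> \<le> 101 / 400 * \<alpha>"
    "0 < x powr (- \<alpha>) + \<alpha>\<^sup>2 / 4 * T"
proof -
  define a where "a = \<alpha> * b"
  have "\<bar>T\<bar> * x powr \<alpha> \<le> 1 * (101 / 100)"
    using x T by (intro mult_mono) auto
  then have "\<alpha> / 4 * (\<bar>T\<bar> * x powr \<alpha>) \<le> \<alpha> / 4 * (101 / 100)"
    using \<alpha> by (intro mult_left_mono) auto
  then have b: "\<bar>b\<bar> \<le> 101 / 400 * \<alpha>"
    using \<alpha> by (simp add: b_def abs_mult mult_ac)
  have "\<bar>a\<bar> = \<alpha> * \<bar>b\<bar>"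
    using \<alpha> by (simp add: a_def abs_mult)
  also have "\<dots> \<le> 1 / 16 * (101 / 400 * (1 / 16))"
    using b \<alpha> by (intro mult_mono) auto
  finally have a: "\<bar>a\<bar> \<le> 1 / 1000"
    by simp
  have ba: "b = a / \<alpha>"
    using \<alpha> by (simp add: a_def)
  have xx: "x powr (- \<alpha>) * x powr \<alpha> = 1"
    using x by (simp flip: powr_add)
  have eq: "x powr (- \<alpha>) + \<alpha>\<^sup>2 / 4 * T = x powr (- \<alpha>) * (1 + a)"
    using xx by (simp add: a_def b_def power2_eq_square algebra_simps)
  have y: "y = x * (1 + a) powr (- 1 / \<alpha>)"
    unfolding y_def eq using a \<alpha> x by (simp add: powr_mult powr_powr)
  define \<theta> where "\<theta> = (1 + a) powr (- 1 / \<alpha>) - 1"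
  have powr_eq: "(1 + a) powr (- 1 / \<alpha>) = exp (- (ln (1 + a) / \<alpha>))"
    using a by (simp add: powr_def)
  have "1 - b \<le> exp (- b)"
    using exp_ge_add_one_self[of "- b"] by simp
  also have "\<dots> \<le> exp (- (ln (1 + a) / \<alpha>))"
    using ln_add_one_self_le_self2[of a] a \<alpha> by (simp add: ba divide_right_mono)
  finally have lower: "- b \<le> \<theta>"
    unfolding \<theta>_def powr_eq by simp
  \<comment> \<open>This is \<open>(a - 2 * a\<^sup>2) / \<alpha>\<close>, a lower bound for
    \<open>ln (1 + a) / \<alpha>\<close>.\<close>
  define w where "w = b * (1 - 2 * a)"
  have "\<bar>1 - 2 * a\<bar> \<le> 2"
    using a by linarith
  moreover have "\<bar>b\<bar> \<le> 1 / 2"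
    using b \<alpha> by linarith
  ultimately have "\<bar>b\<bar> * \<bar>1 - 2 * a\<bar> \<le> 1 / 2 * 2"
    by (intro mult_mono) auto
  then have w1: "\<bar>- w\<bar> \<le> 1"
    by (simp add: w_def abs_mult)
  have "\<bar>ln (1 + a) - a\<bar> \<le> 2 * a\<^sup>2"
    using a by (intro abs_ln_one_plus_x_minus_x_bound) auto
  then have "a - 2 * a\<^sup>2 \<le> ln (1 + a)"
    by linarith
  then have "(a - 2 * a\<^sup>2) / \<alpha> \<le> ln (1 + a) / \<alpha>"
    using \<alpha> by (intro divide_right_mono) auto
  moreover have "(a - 2 * a\<^sup>2) / \<alpha> = w"
    using \<alpha> by (simp add: w_def ba field_simps power2_eq_square)
  ultimately have "exp (- (ln (1 + a) / \<alpha>)) \<le> exp (- w)"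
    by simp
  also have "\<dots> \<le> 1 + (- w) + (- w)\<^sup>2"
    by (rule exp_le_quadratic[OF w1])
  finally have "\<theta> \<le> - w + w\<^sup>2"
    unfolding \<theta>_def powr_eq by simp
  also have "\<dots> = - b + b\<^sup>2 * (2 * \<alpha> + (1 - 2 * a)\<^sup>2)"
    by (simp add: w_def a_def power2_eq_square algebra_simps)
  also have "\<dots> \<le> - b + b\<^sup>2 * (6 / 5)"
  proof -
    have "(1 - 2 * a)\<^sup>2 \<le> (1002 / 1000)\<^sup>2"
      using a by (intro power_mono) auto
    then have "2 * \<alpha> + (1 - 2 * a)\<^sup>2 \<le> 6 / 5"
      using \<alpha> by (simp add: power2_eq_square)
    then show ?thesis
      by (intro add_left_mono mult_left_mono) auto
  qed
  finally have upper: "\<theta> \<le> - b + 6 / 5 * b\<^sup>2"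
    by simp
  show thesis
  proof (rule that[OF _ lower upper b])
    show "y = x * (1 + \<theta>)"
      by (simp add: y \<theta>_def)
    show "0 < x powr (- \<alpha>) + \<alpha>\<^sup>2 / 4 * T"
      unfolding eq using a x by (intro mult_pos_pos) auto
  qed
qed

text \<open>Truncation cost, divergence, first-order change and second-order error, per unit of
  \<open>x $ j\<close>; \<open>\<kappa>\<close> stands for \<open>\<alpha> * \<eta>\<close> and
  \<open>q\<close> for \<open>x $ j powr \<alpha>\<close>. All four are compared with
  \<open>\<alpha> * P\<close> for \<open>P = g * T\<close>: the first-order gain, about
  \<open>q / 4\<close>, outweighs \<open>1 / 16\<close>, \<open>1 / 200\<close> and
  \<open>q\<^sup>2 / 7\<close>.\<close>

lemma coordinate_progress:
  fixes \<alpha> \<kappa> g q \<theta> T b :: real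
  defines "T \<equiv> min g 1"
  defines "b \<equiv> \<alpha> / 4 * T * q"
  assumes \<alpha>: "0 < \<alpha>" "\<alpha> \<le> 1 / 16" and \<kappa>: "0 < \<kappa>" "\<kappa> \<le> 1 / 4" and g: "- 1 \<le> g"
    and q: "12 / 25 \<le> q" "q \<le> 101 / 100"
    and \<theta>: "- b \<le> \<theta>" "\<theta> \<le> - b + 6 / 5 * b\<^sup>2"
  shows "\<alpha> * \<kappa> / 4 * (g - T) + \<alpha> * \<kappa> / 4 * T * (- \<theta>) + g * \<theta> + 51 / 50 / \<alpha> * ((1 + g) * \<theta>\<^sup>2) \<le> 0"
proof -
  have T: "\<bar>T\<bar> \<le> 1"
    using g by (auto simp: T_def)
  \<comment> \<open>This covers both regimes: \<open>P\<close> is \<open>T\<^sup>2\<close> without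
    truncation and \<open>g\<close> with it.\<close>
  define P where "P = g * T"
  have TT: "T\<^sup>2 \<le> P"
  proof (cases "g \<le> 1")
    case True
    then show ?thesis by (simp add: P_def T_def power2_eq_square)
  next
    case False
    then show ?thesis by (simp add: P_def T_def)
  qed
  have P0: "0 \<le> P"
    using TT zero_le_power2[of T] by linarith
  have gT: "g - T \<le> P"
    using TT by (cases "g \<le> 1") (auto simp: P_def T_def)
  have gT2: "(1 + g) * T\<^sup>2 \<le> 2 * P"
  proof (cases "g \<le> 1")
    case True
    then have "(1 + g) * T\<^sup>2 \<le> 2 * T\<^sup>2"
      by (intro mult_right_mono) auto
    then show ?thesis using TT by linarith
  next
    case False
    then show ?thesis by (simp add: P_def T_def)
  qed
  have "\<bar>T\<bar> * q \<le> 1 * (101 / 100)"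
    using T q by (intro mult_mono) auto
  then have "\<alpha> / 4 * (\<bar>T\<bar> * q) \<le> (1 / 16) / 4 * (1 * (101 / 100))"
    using \<alpha> q T by (intro mult_mono) auto
  then have babs: "\<bar>b\<bar> \<le> 1 / 63"
    using \<alpha> q by (simp add: b_def abs_mult mult_ac)
  \<comment> \<open>Replacing \<open>\<theta>\<close> by its first-order value \<open>- b\<close>
    costs at most 2 percent.\<close>
  have dev: "\<bar>\<theta> + b\<bar> \<le> 1 / 50 * \<bar>b\<bar>"
  proof -
    have "6 / 5 * b\<^sup>2 = 6 / 5 * \<bar>b\<bar> * \<bar>b\<bar>"
      by (simp add: power2_eq_square)
    also have "\<dots> \<le> 1 / 50 * \<bar>b\<bar>"
      using babs by (intro mult_right_mono) auto
    finally show ?thesis using \<theta> by linarith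
  qed
  have sq: "\<theta>\<^sup>2 \<le> 53 / 50 * b\<^sup>2" 
  proof -
    have "\<bar>\<theta>\<bar> \<le> 51 / 50 * \<bar>b\<bar>"
      using dev by linarith
    then have "\<bar>\<theta>\<bar>\<^sup>2 \<le> (51 / 50 * \<bar>b\<bar>)\<^sup>2"
      by (intro power_mono) auto
    also have "\<dots> \<le> 53 / 50 * b\<^sup>2"
      by (simp add: power_mult_distrib power2_eq_square)
    finally show ?thesis by simp
  qed
  have gb: "\<bar>g\<bar> * \<bar>b\<bar> = \<alpha> / 4 * q * P" 
  proof -
    have "\<bar>g\<bar> * \<bar>b\<bar> = \<alpha> / 4 * q * \<bar>P\<bar>"
      using \<alpha> q by (simp add: b_def P_def abs_mult)
    then show ?thesis using P0 by simp
  qed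
  have e1: "\<alpha> * \<kappa> / 4 * (g - T) \<le> \<alpha> / 16 * P"
  proof -
    have "\<kappa> * (g - T) \<le> 1 / 4 * P"
      using gT \<kappa> P0 by (intro mult_mono) (auto simp: T_def)
    then have "\<alpha> / 4 * (\<kappa> * (g - T)) \<le> \<alpha> / 4 * (1 / 4 * P)"
      using \<alpha> by (intro mult_left_mono) auto
    then show ?thesis by simp
  qed
  have e2: "\<alpha> * \<kappa> / 4 * T * (- \<theta>) \<le> \<alpha> / 200 * P"
  proof -
    have "\<bar>T\<bar> * \<bar>\<theta>\<bar> \<le> \<bar>T\<bar> * (51 / 50 * \<bar>b\<bar>)"
      using dev by (intro mult_left_mono) linarith+
    also have "\<dots> = 51 / 50 * (\<alpha> / 4 * q * T\<^sup>2)"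
      using \<alpha> q by (simp add: b_def abs_mult power2_eq_square)
    also have "\<dots> \<le> 51 / 50 * ((1 / 16) / 4 * (101 / 100) * P)"
      using \<alpha> q TT P0 by (intro mult_mono) auto
    also have "\<dots> \<le> 1 / 50 * P" using P0 by simp
    finally have "\<kappa> * (\<bar>T\<bar> * \<bar>\<theta>\<bar>) \<le> 1 / 4 * (1 / 50 * P)"
      using \<kappa> by (intro mult_mono[of \<kappa> "1 / 4" "\<bar>T\<bar> * \<bar>\<theta>\<bar>"]) auto
    moreover have "\<kappa> * (T * (- \<theta>)) \<le> \<kappa> * (\<bar>T\<bar> * \<bar>\<theta>\<bar>)"
      using \<kappa> abs_ge_self[of "T * (- \<theta>)"] by (intro mult_left_mono) (auto simp: abs_mult)
    ultimately have "\<alpha> / 4 * (\<kappa> * (T * (- \<theta>))) \<le> \<alpha> / 4 * (1 / 4 * (1 / 50 * P))"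
      using \<alpha> by (intro mult_left_mono) auto
    moreover have "0 \<le> \<alpha> * P"
      using \<alpha> P0 by simp
    ultimately show ?thesis by (simp add: algebra_simps)
  qed
  have e3: "g * \<theta> \<le> - (49 / 50) * (\<alpha> / 4 * q * P)"
  proof -
    have "g * (\<theta> + b) \<le> \<bar>g\<bar> * \<bar>\<theta> + b\<bar>"
      using abs_ge_self[of "g * (\<theta> + b)"] by (simp add: abs_mult)
    also have "\<dots> \<le> \<bar>g\<bar> * (1 / 50 * \<bar>b\<bar>)"
      using dev by (intro mult_left_mono) auto
    also have "\<dots> = 1 / 50 * (\<alpha> / 4 * q * P)"
      unfolding gb[symmetric] by simp
    finally have "g * \<theta> + g * b \<le> 1 / 50 * (\<alpha> / 4 * q * P)"
      by (simp add: distrib_left)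
    moreover have "g * b = \<alpha> / 4 * q * P"
      by (simp add: b_def P_def)
    ultimately show ?thesis by linarith
  qed
  have e4: "51 / 50 / \<alpha> * ((1 + g) * \<theta>\<^sup>2) \<le> 1 / 7 * (\<alpha> * q\<^sup>2 * P)"
  proof -
    have "(1 + g) * \<theta>\<^sup>2 \<le> (1 + g) * (53 / 50 * b\<^sup>2)"
      using g sq by (intro mult_left_mono) auto
    also have "\<dots> = 53 / 50 * \<alpha>\<^sup>2 / 16 * q\<^sup>2 * ((1 + g) * T\<^sup>2)"
      by (simp add: b_def power_mult_distrib field_simps)
    also have "\<dots> \<le> 53 / 50 * \<alpha>\<^sup>2 / 16 * q\<^sup>2 * (2 * P)"
      using gT2 by (intro mult_left_mono) auto
    finally have "51 / 50 / \<alpha> * ((1 + g) * \<theta>\<^sup>2) \<le> 51 / 50 / \<alpha> * (53 / 50 * \<alpha>\<^sup>2 / 16 * q\<^sup>2 * (2 * P))"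
      using \<alpha> by (intro mult_left_mono) auto
    also have "\<dots> = 51 / 50 * 53 / 50 / 8 * (\<alpha> * q\<^sup>2 * P)"
      using \<alpha> by (simp add: field_simps power2_eq_square)
    also have "\<dots> \<le> 1 / 7 * (\<alpha> * q\<^sup>2 * P)"
      using \<alpha> P0 by (intro mult_right_mono) auto
    finally show ?thesis .
  qed
  \<comment> \<open>A convex quadratic, negative at both ends of the interval for \<open>q\<close>;
    the product of the distances to the ends bounds \<open>q\<^sup>2\<close> by its chord. It is
    positive at \<open>q = 0\<close>, so \<open>q\<close> has to stay away from 0.\<close>
  have quad: "1 / 16 + 1 / 200 - 49 / 200 * q + 1 / 7 * q\<^sup>2 \<le> 0"
  proof -
    have "(q - 12 / 25) * (101 / 100 - q) \<ge> 0"
      using q by simp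
    then have "q\<^sup>2 \<le> 149 / 100 * q - 303 / 625"
      unfolding power2_eq_square left_diff_distrib right_diff_distrib by linarith
    then show ?thesis using q by linarith
  qed
  have "\<alpha> * P * (1 / 16 + 1 / 200 - 49 / 200 * q + 1 / 7 * q\<^sup>2) \<le> 0"
    using \<alpha> P0 quad by (simp add: mult_nonneg_nonpos)
  moreover have "\<alpha> * P * (1 / 16 + 1 / 200 - 49 / 200 * q + 1 / 7 * q\<^sup>2) =
      \<alpha> / 16 * P + \<alpha> / 200 * P - 49 / 50 * (\<alpha> / 4 * q * P) + 1 / 7 * (\<alpha> * q\<^sup>2 * P)"
    by (simp add: algebra_simps)
  ultimately show ?thesis
    using e1 e2 e3 e4 by linarith
qed

section \<open>Convexity and local smoothness of the penalized objective\<close>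

text \<open>The closed form of the partial derivatives of \<open>f_alpha\<close>;
  \<open>gradient_f_alpha\<close> identifies it with \<open>gradient\<close> at positive
  points.\<close>

definition pgrad :: "real ^ 'n ^ 'm \<Rightarrow> real \<Rightarrow> real ^ 'n \<Rightarrow> 'n \<Rightarrow> real" where
  "pgrad A \<alpha> x j = - 1 + (\<Sum>i\<in>UNIV. A $ i $ j * (A *v x) $ i powr (1 / \<alpha>))"

text \<open>The derivative in direction \<open>h\<close>, with the sums exchanged so that estimates
  can be made row by row.\<close>

lemma sum_pgrad_mult:
  "(\<Sum>j\<in>UNIV. pgrad A \<alpha> x j * h j) =
    - (\<Sum>j\<in>UNIV. h j) + (\<Sum>i\<in>UNIV. (A *v x) $ i powr (1 / \<alpha>) * (\<Sum>j\<in>UNIV. A $ i $ j * h j))"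
proof -
  have "(\<Sum>i\<in>UNIV. (A *v x) $ i powr (1 / \<alpha>) * (\<Sum>j\<in>UNIV. A $ i $ j * h j)) =
      (\<Sum>i\<in>UNIV. \<Sum>j\<in>UNIV. A $ i $ j * (A *v x) $ i powr (1 / \<alpha>) * h j)"
    by (simp add: sum_distrib_left mult_ac)
  also have "\<dots> = (\<Sum>j\<in>UNIV. \<Sum>i\<in>UNIV. A $ i $ j * (A *v x) $ i powr (1 / \<alpha>) * h j)"
    by (rule sum.swap)
  finally show ?thesis
    by (simp add: pgrad_def left_diff_distrib sum_subtractf sum_distrib_right)
qed

lemma f_alpha_diff_le:
  fixes A :: "real ^ 'n ^ 'm"
  assumes A: "\<And>i j. 0 \<le> A $ i $ j" and x: "\<And>j. 0 < x $ j" and u: "\<And>j. 0 \<le> u $ j" and \<alpha>: "0 < \<alpha>"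
  shows "f_alpha A \<alpha> x - f_alpha A \<alpha> u \<le> (\<Sum>j\<in>UNIV. pgrad A \<alpha> x j * (x $ j - u $ j))"
proof -
  let ?q = "(1 + \<alpha>) / \<alpha>"
  have row: "\<alpha> / (1 + \<alpha>) * (A *v x) $ i powr ?q + (A *v x) $ i powr (1 / \<alpha>) * ((A *v u) $ i - (A *v x) $ i)
      \<le> \<alpha> / (1 + \<alpha>) * (A *v u) $ i powr ?q" for i
  proof -
    have q: "1 < ?q" "?q - 1 = 1 / \<alpha>" "c / ?q = \<alpha> / (1 + \<alpha>) * c" for c
      using \<alpha> by (auto simp: field_simps)
    have s: "0 \<le> (A *v x) $ i" "0 \<le> (A *v u) $ i"
      using A x u by (auto simp: matrix_vector_mult_def less_imp_le intro!: sum_nonneg)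
    \<comment> \<open>Since \<open>x\<close> is positive, a row with value 0 is a zero row; this is
      the degenerate case of \<open>powr_tangent_le\<close>.\<close>
    have "(A *v u) $ i = 0" if "(A *v x) $ i = 0"
    proof -
      have "\<forall>j\<in>UNIV. A $ i $ j * x $ j = 0"
        using that A x by (subst (asm) matrix_vector_mult_def, subst sum_nonneg_eq_0_iff[symmetric])
          (auto simp: less_imp_le)
      then have "A $ i $ j = 0" for j
        using x[of j] by auto
      then show ?thesis
        by (simp add: matrix_vector_mult_def)
    qed
    then show ?thesis
      using powr_tangent_le[OF s q(1)] unfolding q by blast
  qed
  have "(\<Sum>j\<in>UNIV. pgrad A \<alpha> x j * (x $ j - u $ j)) = - (\<Sum>j\<in>UNIV. x $ j - u $ j)
      + (\<Sum>i\<in>UNIV. (A *v x) $ i powr (1 / \<alpha>) * ((A *v x) $ i - (A *v u) $ i))"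
    unfolding sum_pgrad_mult by (simp add: matrix_vector_mult_def[of A] right_diff_distrib sum_subtractf)
  moreover have "(\<Sum>i\<in>UNIV. \<alpha> / (1 + \<alpha>) * (A *v x) $ i powr ?q + (A *v x) $ i powr (1 / \<alpha>) * ((A *v u) $ i - (A *v x) $ i))
      \<le> (\<Sum>i\<in>UNIV. \<alpha> / (1 + \<alpha>) * (A *v u) $ i powr ?q)"
    by (intro sum_mono row)
  moreover have "(\<Sum>i\<in>UNIV. (A *v x) $ i powr (1 / \<alpha>) * ((A *v u) $ i - (A *v x) $ i)) =
     - (\<Sum>i\<in>UNIV. (A *v x) $ i powr (1 / \<alpha>) * ((A *v x) $ i - (A *v u) $ i))"
    by (simp add: sum_negf[symmetric] algebra_simps)
  ultimately show ?thesis
    by (simp add: f_alpha_def inner_vec_def sum.distrib sum_distrib_left sum_subtractf)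
qed

text \<open>The relative change \<open>r\<close> of a row is the average of the
  \<open>\<theta> j\<close> with weights \<open>A $ i $ j * x $ j\<close>. So
  \<open>\<bar>r\<bar> \<le> \<rho>\<close>, \<open>powr_second_order_le\<close> applies to each
  row, and Jensen's inequality turns \<open>r\<^sup>2\<close> into the average of the
  \<open>(\<theta> j)\<^sup>2\<close>.\<close>

lemma f_alpha_second_order_le:
  fixes A :: "real ^ 'n ^ 'm" and \<theta> :: "'n \<Rightarrow> real"
  assumes A: "\<And>i j. 0 \<le> A $ i $ j" and x: "\<And>j. 0 < x $ j" and \<alpha>: "0 < \<alpha>" "\<alpha> < 1"
    and y: "\<And>j. y $ j = x $ j * (1 + \<theta> j)" and \<theta>: "\<And>j. \<bar>\<theta> j\<bar> \<le> \<rho>" and \<rho>: "\<rho> \<le> \<alpha>"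
  shows "f_alpha A \<alpha> y \<le> f_alpha A \<alpha> x + (\<Sum>j\<in>UNIV. pgrad A \<alpha> x j * (x $ j * \<theta> j))
    + (1 + \<rho>) / \<alpha> * (\<Sum>j\<in>UNIV. (1 + pgrad A \<alpha> x j) * (x $ j * (\<theta> j)\<^sup>2))"
proof -
  let ?q = "(1 + \<alpha>) / \<alpha>"
  have row: "\<alpha> / (1 + \<alpha>) * (A *v y) $ i powr ?q \<le> \<alpha> / (1 + \<alpha>) * (A *v x) $ i powr ?q
      + (A *v x) $ i powr (1 / \<alpha>) * (\<Sum>j\<in>UNIV. A $ i $ j * (x $ j * \<theta> j))
      + (1 + \<rho>) / \<alpha> * ((A *v x) $ i powr (1 / \<alpha>) * (\<Sum>j\<in>UNIV. A $ i $ j * (x $ j * (\<theta> j)\<^sup>2)))" for i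
  proof -
    define w where "w j = A $ i $ j * x $ j" for j
    define s where "s = (A *v x) $ i"
    have w: "0 \<le> w j" for j
      using A x[of j] by (simp add: w_def)
    have s_eq: "s = (\<Sum>j\<in>UNIV. w j)"
      by (simp add: s_def w_def matrix_vector_mult_def)
    have s: "0 \<le> s"
      unfolding s_eq by (intro sum_nonneg w)
    \<comment> \<open>If \<open>s = 0\<close>, all weights vanish, and the value 0 keeps both
      \<open>sr\<close> and the bound on \<open>r\<close> true.\<close>
    define r where "r = (if s = 0 then 0 else (\<Sum>j\<in>UNIV. w j * \<theta> j) / s)"
    have sr: "s * r = (\<Sum>j\<in>UNIV. w j * \<theta> j)"
    proof (cases "s = 0")
      case True
      then have "w j = 0" for j
        using w unfolding s_eq by (subst (asm) sum_nonneg_eq_0_iff) auto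
      then show ?thesis using True by simp
    qed (simp add: r_def)
    have "\<bar>s * r\<bar> \<le> (\<Sum>j\<in>UNIV. \<bar>w j * \<theta> j\<bar>)"
      unfolding sr by (rule sum_abs)
    also have "\<dots> \<le> (\<Sum>j\<in>UNIV. w j * \<rho>)"
      using w \<theta> by (intro sum_mono) (simp add: abs_mult mult_left_mono)
    also have "\<dots> = s * \<rho>"
      by (simp add: s_eq sum_distrib_right)
    finally have "s * \<bar>r\<bar> \<le> s * \<rho>"
      using s by (simp add: abs_mult)
    moreover have "0 \<le> \<rho>"
      using \<theta>[of undefined] by linarith
    ultimately have r: "\<bar>r\<bar> \<le> \<rho>"
    proof (cases "s = 0")
      case False
      then show ?thesis
        using s \<open>s * \<bar>r\<bar> \<le> s * \<rho>\<close> by (metis mult_le_cancel_left_pos order_less_le)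
    qed (simp add: r_def)
    \<comment> \<open>The weighted variance of \<open>\<theta>\<close> is nonnegative.\<close>
    have "0 \<le> (\<Sum>j\<in>UNIV. w j * (\<theta> j - r)\<^sup>2)"
      using w by (intro sum_nonneg) auto
    also have "\<dots> = (\<Sum>j\<in>UNIV. w j * (\<theta> j)\<^sup>2) - 2 * r * (\<Sum>j\<in>UNIV. w j * \<theta> j) + r\<^sup>2 * (\<Sum>j\<in>UNIV. w j)"
      by (simp add: power2_eq_square algebra_simps sum.distrib sum_subtractf sum_distrib_left)
    also have "\<dots> = (\<Sum>j\<in>UNIV. w j * (\<theta> j)\<^sup>2) - s * r\<^sup>2"
      by (simp add: sr[symmetric] s_eq[symmetric] power2_eq_square)
    finally have var: "s * r\<^sup>2 \<le> (\<Sum>j\<in>UNIV. w j * (\<theta> j)\<^sup>2)"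
      by simp
    have Ay: "(A *v y) $ i = s * (1 + r)"
      unfolding distrib_left sr unfolding s_eq
      by (simp add: matrix_vector_mult_def y w_def algebra_simps sum.distrib)
    have "(1 + \<bar>r\<bar>) / \<alpha> * (s powr (1 / \<alpha>) * (s * r\<^sup>2)) \<le>
        (1 + \<rho>) / \<alpha> * (s powr (1 / \<alpha>) * (\<Sum>j\<in>UNIV. w j * (\<theta> j)\<^sup>2))"
      using r var s \<alpha> by (intro mult_mono divide_right_mono mult_left_mono) auto
    moreover have "\<bar>r\<bar> \<le> \<alpha>"
      using r \<rho> by linarith
    ultimately have "\<alpha> / (1 + \<alpha>) * (A *v y) $ i powr ?q \<le> \<alpha> / (1 + \<alpha>) * s powr ?q
      + s powr (1 / \<alpha>) * (\<Sum>j\<in>UNIV. w j * \<theta> j)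
      + (1 + \<rho>) / \<alpha> * (s powr (1 / \<alpha>) * (\<Sum>j\<in>UNIV. w j * (\<theta> j)\<^sup>2))"
      using powr_second_order_le[OF s \<alpha>, of r] unfolding Ay sr[symmetric] by linarith
    then show ?thesis
      by (simp add: s_def w_def mult.assoc)
  qed
  have sq: "(\<Sum>j\<in>UNIV. (1 + pgrad A \<alpha> x j) * (x $ j * (\<theta> j)\<^sup>2)) =
      (\<Sum>i\<in>UNIV. (A *v x) $ i powr (1 / \<alpha>) * (\<Sum>j\<in>UNIV. A $ i $ j * (x $ j * (\<theta> j)\<^sup>2)))"
    unfolding distrib_right sum.distrib sum_pgrad_mult by simp
  have lin: "(\<Sum>j\<in>UNIV. y $ j) = (\<Sum>j\<in>UNIV. x $ j) + (\<Sum>j\<in>UNIV. x $ j * \<theta> j)"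
    by (simp add: y distrib_left sum.distrib)
  have "(\<Sum>i\<in>UNIV. \<alpha> / (1 + \<alpha>) * (A *v y) $ i powr ?q) \<le> (\<Sum>i\<in>UNIV. \<alpha> / (1 + \<alpha>) * (A *v x) $ i powr ?q
      + (A *v x) $ i powr (1 / \<alpha>) * (\<Sum>j\<in>UNIV. A $ i $ j * (x $ j * \<theta> j))
      + (1 + \<rho>) / \<alpha> * ((A *v x) $ i powr (1 / \<alpha>) * (\<Sum>j\<in>UNIV. A $ i $ j * (x $ j * (\<theta> j)\<^sup>2))))"
    by (intro sum_mono row)
  then show ?thesis
    unfolding sq sum_pgrad_mult f_alpha_def by (simp add: inner_vec_def sum.distrib sum_distrib_left lin)
qed

section \<open>One step of the algorithm\<close>

text \<open>What a single step needs to know about the current iterate, detached from the run. The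
  last two assumptions confine \<open>x $ j powr \<alpha>\<close> to the interval used in
  \<open>coordinate_progress\<close>.\<close>

locale packing_step =
  fixes A :: "real ^ 'n ^ 'm" and x :: "real ^ 'n" and \<alpha> :: real
  assumes A_nonneg: "\<And>i j. 0 \<le> A $ i $ j"
    and A_ge_1: "\<And>i j. A $ i $ j \<noteq> 0 \<Longrightarrow> 1 \<le> A $ i $ j"
    and A_column: "\<And>j. \<exists>i. A $ i $ j \<noteq> 0"
    and \<alpha>: "0 < \<alpha>" "\<alpha> \<le> 1 / 16"
    and x_pos: "\<And>j. 0 < x $ j"
    and x_lower: "\<And>j. x $ j powr (- \<alpha>) \<le> 25 / 12"
    and Ax_le: "\<And>i. (A *v x) $ i \<le> 1 + \<alpha>"
begin

definition T :: "'n \<Rightarrow> real" where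
  "T j = min (pgrad A \<alpha> x j) 1"

text \<open>The next iterate with the dual variable eliminated: \<open>1 + z $ j / \<eta>\<close> is
  \<open>x $ j powr (- \<alpha>)\<close>, and \<open>\<alpha>\<^sup>2 / 4\<close> is
  \<open>gamma / \<eta>\<close>.\<close>

definition y :: "real ^ 'n" where
  "y = (\<chi> j. (x $ j powr (- \<alpha>) + \<alpha>\<^sup>2 / 4 * T j) powr (- 1 / \<alpha>))"

definition b :: "'n \<Rightarrow> real" where
  "b j = \<alpha> / 4 * T j * x $ j powr \<alpha>"

definition \<theta> :: "'n \<Rightarrow> real" where
  "\<theta> j = y $ j / x $ j - 1"

lemma pgrad_ge: "- 1 \<le> pgrad A \<alpha> x j"
  unfolding pgrad_def using A_nonneg by (simp add: sum_nonneg)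

lemma abs_T_le: "\<bar>T j\<bar> \<le> 1"
  using pgrad_ge[of j] by (auto simp: T_def)

text \<open>Every column has an entry at least 1, so \<open>x $ j\<close> is at most some row value,
  hence at most \<open>1 + \<alpha>\<close>, and
  \<open>(1 + \<alpha>) powr \<alpha> \<le> exp (\<alpha>\<^sup>2)\<close>. The lower bound is the
  reciprocal of \<open>x_lower\<close>.\<close>

lemma x_powr_bounds: "12 / 25 \<le> x $ j powr \<alpha>" "x $ j powr \<alpha> \<le> 101 / 100"
proof -
  show "12 / 25 \<le> x $ j powr \<alpha>"
    using x_lower[of j] x_pos[of j] by (simp add: powr_minus_divide field_simps)
  obtain i where "A $ i $ j \<noteq> 0"
    using A_column by blast
  then have "1 * x $ j \<le> A $ i $ j * x $ j"
    using A_ge_1 x_pos[of j] by (intro mult_right_mono) auto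
  also have "\<dots> \<le> (A *v x) $ i"
    using A_nonneg x_pos unfolding matrix_vector_mult_def vec_lambda_beta
    by (intro member_le_sum) (auto simp: less_imp_le)
  also have "\<dots> \<le> 1 + \<alpha>"
    by (rule Ax_le)
  finally have "x $ j powr \<alpha> \<le> (1 + \<alpha>) powr \<alpha>"
    using x_pos[of j] \<alpha> by (intro powr_mono2) auto
  also have "\<dots> = exp (\<alpha> * ln (1 + \<alpha>))"
    using \<alpha> by (simp add: powr_def)
  also have "\<dots> \<le> exp (1 / 16 * (1 / 16))"
    using \<alpha> ln_add_one_self_le_self[of \<alpha>] unfolding exp_le_cancel_iff by (intro mult_mono) auto
  also have "\<dots> \<le> 101 / 100"
    using exp_le_quadratic[of "1 / 16 * (1 / 16)"] by (simp add: power2_eq_square)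
  finally show "x $ j powr \<alpha> \<le> 101 / 100" .
qed

lemma y_bounds:
  shows y_eq: "y $ j = x $ j * (1 + \<theta> j)"
    and \<theta>_lower: "- b j \<le> \<theta> j"
    and \<theta>_upper: "\<theta> j \<le> - b j + 6 / 5 * (b j)\<^sup>2"
    and abs_b_le: "\<bar>b j\<bar> \<le> 101 / 400 * \<alpha>"
    and y_base_pos: "0 < x $ j powr (- \<alpha>) + \<alpha>\<^sup>2 / 4 * T j"
proof -
  obtain t where t: "y $ j = x $ j * (1 + t)" "- b j \<le> t" "t \<le> - b j + 6 / 5 * (b j)\<^sup>2"
    "\<bar>b j\<bar> \<le> 101 / 400 * \<alpha>" "0 < x $ j powr (- \<alpha>) + \<alpha>\<^sup>2 / 4 * T j"
    using mirror_step_bounds[OF x_pos x_powr_bounds(2) \<alpha> abs_T_le, of j j]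
    unfolding b_def y_def vec_lambda_beta by metis
  moreover have "\<theta> j = t"
    using x_pos[of j] by (simp add: \<theta>_def t(1))
  ultimately show "y $ j = x $ j * (1 + \<theta> j)" "- b j \<le> \<theta> j" "\<theta> j \<le> - b j + 6 / 5 * (b j)\<^sup>2"
    "\<bar>b j\<bar> \<le> 101 / 400 * \<alpha>" "0 < x $ j powr (- \<alpha>) + \<alpha>\<^sup>2 / 4 * T j"
    by auto
qed

lemma y_pos: "0 < y $ j"
  using y_base_pos[of j] by (simp add: y_def)

lemma y_powr: "y $ j powr (- \<alpha>) = x $ j powr (- \<alpha>) + \<alpha>\<^sup>2 / 4 * T j"
  using y_base_pos[of j] \<alpha> by (simp add: y_def powr_powr)

lemma b_square_le: "6 / 5 * (b j)\<^sup>2 \<le> 1 / 50 * \<bar>b j\<bar>"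
proof -
  have "6 / 5 * \<bar>b j\<bar> * \<bar>b j\<bar> \<le> 1 / 50 * \<bar>b j\<bar>"
    using abs_b_le[of j] \<alpha> by (intro mult_right_mono) auto
  then show ?thesis by (simp add: power2_eq_square)
qed

lemma abs_\<theta>_le: "\<bar>\<theta> j\<bar> \<le> 13 / 50 * \<alpha>"
  using \<theta>_lower[of j] \<theta>_upper[of j] b_square_le[of j] abs_b_le[of j] \<alpha> by linarith

text \<open>A row with value at most 1 grows by a factor of at most \<open>1 + \<alpha>\<close> in
  one step; a row above 1 does not grow at all.\<close>

lemma Ay_le: "(A *v y) $ i \<le> 1 + \<alpha>"
proof (cases "(A *v x) $ i \<le> 1")
  case True
  have "(A *v y) $ i \<le> (\<Sum>j\<in>UNIV. (1 + \<alpha>) * (A $ i $ j * x $ j))"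
    unfolding matrix_vector_mult_def vec_lambda_beta
  proof (rule sum_mono)
    fix j
    have "1 + \<theta> j \<le> 1 + \<alpha>"
      using abs_\<theta>_le[of j] \<alpha> by linarith
    then have "A $ i $ j * x $ j * (1 + \<theta> j) \<le> A $ i $ j * x $ j * (1 + \<alpha>)"
      using A_nonneg x_pos[of j] by (intro mult_left_mono) auto
    then show "A $ i $ j * y $ j \<le> (1 + \<alpha>) * (A $ i $ j * x $ j)"
      by (simp add: y_eq mult_ac)
  qed
  also have "\<dots> = (1 + \<alpha>) * (A *v x) $ i"
    by (simp add: matrix_vector_mult_def sum_distrib_left)
  also have "\<dots> \<le> (1 + \<alpha>) * 1"
    using True \<alpha> by (intro mult_left_mono) auto
  finally show ?thesis by simp
next
  case False
  have "A $ i $ j * y $ j \<le> A $ i $ j * x $ j" for j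
  proof (cases "A $ i $ j = 0")
    case nz: False
    \<comment> \<open>The violated row alone contributes at least 1 to the partial derivative in
      \<open>j\<close>, which cancels the \<open>- 1\<close>; so coordinate \<open>j\<close> does
      not increase.\<close>
    have "1 * 1 \<le> A $ i $ j * (A *v x) $ i powr (1 / \<alpha>)"
      using A_ge_1[OF nz] False \<alpha> by (intro mult_mono ge_one_powr_ge_zero) auto
    also have "\<dots> \<le> 1 + pgrad A \<alpha> x j"
      unfolding pgrad_def using A_nonneg member_le_sum[of i UNIV "\<lambda>i. A $ i $ j * (A *v x) $ i powr (1 / \<alpha>)"]
      by auto
    finally have "0 \<le> b j"
      using \<alpha> by (simp add: b_def T_def)
    then have "\<theta> j \<le> 0"
      using \<theta>_upper[of j] b_square_le[of j] by linarith
    then have "x $ j * (1 + \<theta> j) \<le> x $ j * 1"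
      using x_pos[of j] by (intro mult_left_mono) auto
    then show ?thesis
      using A_nonneg by (intro mult_left_mono) (auto simp: y_eq)
  qed simp
  then have "(A *v y) $ i \<le> (A *v x) $ i"
    unfolding matrix_vector_mult_def vec_lambda_beta by (intro sum_mono)
  then show ?thesis
    using Ax_le[of i] by linarith
qed

text \<open>The second-order bound for \<open>f_alpha\<close>, combined coordinate by coordinate
  with \<open>coordinate_progress\<close>. The decrease pays for the truncation and for the
  divergence, the two error terms of the regret.\<close>

lemma f_alpha_decrease:
  assumes \<kappa>: "0 < \<alpha> * \<eta>" "\<alpha> * \<eta> \<le> 1 / 4"
  shows "\<alpha>\<^sup>2 * \<eta> / 4 * (\<Sum>j\<in>UNIV. (pgrad A \<alpha> x j - T j) * x $ j) + \<eta> * (\<Sum>j\<in>UNIV. breg \<alpha> (x $ j) (y $ j))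
    \<le> f_alpha A \<alpha> x - f_alpha A \<alpha> y"
proof -
  let ?g = "pgrad A \<alpha> x" and ?k = "\<alpha> * \<eta>"
  have \<eta>: "0 < \<eta>"
    using \<kappa> \<alpha> by (simp add: zero_less_mult_iff)
  have coord: "\<alpha>\<^sup>2 * \<eta> / 4 * ((?g j - T j) * x $ j) + \<eta> * breg \<alpha> (x $ j) (y $ j) +
      (?g j * (x $ j * \<theta> j) + 51 / 50 / \<alpha> * ((1 + ?g j) * (x $ j * (\<theta> j)\<^sup>2))) \<le> 0" for j
  proof -
    have "breg \<alpha> (x $ j) (y $ j) \<le> (x $ j - y $ j) * (\<alpha>\<^sup>2 / 4 * T j)"
      using breg_le_symmetric[OF x_pos y_pos, of \<alpha> j j] \<alpha> by (simp add: y_powr)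
    also have "\<dots> = x $ j * (\<alpha>\<^sup>2 / 4 * T j * (- \<theta> j))"
      by (simp add: y_eq algebra_simps)
    finally have "\<eta> * breg \<alpha> (x $ j) (y $ j) \<le> \<eta> * (x $ j * (\<alpha>\<^sup>2 / 4 * T j * (- \<theta> j)))"
      using \<eta> by (intro mult_left_mono) auto
    moreover have "x $ j * (\<alpha> * ?k / 4 * (?g j - T j) + \<alpha> * ?k / 4 * T j * (- \<theta> j) + ?g j * \<theta> j
        + 51 / 50 / \<alpha> * ((1 + ?g j) * (\<theta> j)\<^sup>2)) \<le> 0"
      using coordinate_progress[OF \<alpha> \<kappa> pgrad_ge x_powr_bounds, of j j "\<theta> j"] \<theta>_lower[of j] \<theta>_upper[of j] x_pos[of j]
      by (intro mult_nonneg_nonpos) (auto simp: T_def b_def)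
    ultimately show ?thesis
      by (simp add: algebra_simps power2_eq_square)
  qed
  have "f_alpha A \<alpha> y \<le> f_alpha A \<alpha> x + (\<Sum>j\<in>UNIV. ?g j * (x $ j * \<theta> j))
    + (1 + 13 / 50 * \<alpha>) / \<alpha> * (\<Sum>j\<in>UNIV. (1 + ?g j) * (x $ j * (\<theta> j)\<^sup>2))"
    using \<alpha> by (intro f_alpha_second_order_le A_nonneg x_pos y_eq abs_\<theta>_le) auto
  also have "(1 + 13 / 50 * \<alpha>) / \<alpha> * (\<Sum>j\<in>UNIV. (1 + ?g j) * (x $ j * (\<theta> j)\<^sup>2)) \<le>
      51 / 50 / \<alpha> * (\<Sum>j\<in>UNIV. (1 + ?g j) * (x $ j * (\<theta> j)\<^sup>2))"
  proof (intro mult_right_mono divide_right_mono sum_nonneg mult_nonneg_nonneg)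
    show "0 \<le> 1 + ?g j" for j
      using pgrad_ge[of j] by linarith
    show "0 \<le> x $ j" for j
      using x_pos[of j] by linarith
  qed (use \<alpha> in auto)
  finally have "f_alpha A \<alpha> y - f_alpha A \<alpha> x \<le> (\<Sum>j\<in>UNIV. ?g j * (x $ j * \<theta> j) +
      51 / 50 / \<alpha> * ((1 + ?g j) * (x $ j * (\<theta> j)\<^sup>2)))"
    by (simp add: sum.distrib sum_distrib_left)
  moreover have "(\<Sum>j\<in>UNIV. \<alpha>\<^sup>2 * \<eta> / 4 * ((?g j - T j) * x $ j) + \<eta> * breg \<alpha> (x $ j) (y $ j) +
      (?g j * (x $ j * \<theta> j) + 51 / 50 / \<alpha> * ((1 + ?g j) * (x $ j * (\<theta> j)\<^sup>2)))) \<le> 0"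
    by (intro sum_nonpos coord)
  ultimately show ?thesis
    unfolding sum.distrib sum_distrib_left by linarith
qed

text \<open>\<open>w\<close> plays the role of \<open>A_iter A \<epsilon> k\<close>, which grows by
  \<open>gamma\<close>. Convexity bounds the regret at \<open>x\<close> by the two error terms
  \<open>S\<close> and a difference of divergences; the decrease of \<open>f_alpha\<close> pays for
  \<open>S\<close>.\<close>

lemma regret_step:
  assumes \<kappa>: "0 < \<alpha> * \<eta>" "\<alpha> * \<eta> \<le> 1 / 4" and u: "\<And>j. 0 \<le> u $ j" and w: "1 \<le> w"
  shows "(w + \<alpha>\<^sup>2 * \<eta> / 4) * f_alpha A \<alpha> y + \<eta> * (\<Sum>j\<in>UNIV. breg \<alpha> (u $ j) (y $ j))
    \<le> w * f_alpha A \<alpha> x + \<eta> * (\<Sum>j\<in>UNIV. breg \<alpha> (u $ j) (x $ j)) + \<alpha>\<^sup>2 * \<eta> / 4 * f_alpha A \<alpha> u"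
proof -
  let ?g = "pgrad A \<alpha> x" and ?\<gamma> = "\<alpha>\<^sup>2 * \<eta> / 4"
  define S where "S = ?\<gamma> * (\<Sum>j\<in>UNIV. (?g j - T j) * x $ j) + \<eta> * (\<Sum>j\<in>UNIV. breg \<alpha> (x $ j) (y $ j))"
  have \<eta>: "0 < \<eta>"
    using \<kappa> \<alpha> by (simp add: zero_less_mult_iff)
  have dec: "S \<le> f_alpha A \<alpha> x - f_alpha A \<alpha> y"
    unfolding S_def by (rule f_alpha_decrease[OF \<kappa>])
  have "0 \<le> S"
    unfolding S_def using \<eta> \<alpha> x_pos y_pos
    by (intro add_nonneg_nonneg mult_nonneg_nonneg sum_nonneg breg_nonneg) (auto simp: T_def less_imp_le)
  moreover have "0 \<le> ?\<gamma>"
    using \<eta> by simp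
  ultimately have "1 * (f_alpha A \<alpha> x - f_alpha A \<alpha> y) \<le> (w + ?\<gamma>) * (f_alpha A \<alpha> x - f_alpha A \<alpha> y)"
    using dec w by (intro mult_right_mono) linarith+
  \<comment> \<open>The decrease is nonnegative, since it dominates \<open>S \<ge> 0\<close>; its
    weight \<open>w + gamma\<close> is at least 1.\<close>
  with dec have progress: "S \<le> (w + ?\<gamma>) * (f_alpha A \<alpha> x - f_alpha A \<alpha> y)"
    unfolding mult_1 by (rule order_trans)
  have "f_alpha A \<alpha> x - f_alpha A \<alpha> u \<le> (\<Sum>j\<in>UNIV. ?g j * (x $ j - u $ j))"
    using \<alpha> by (intro f_alpha_diff_le A_nonneg x_pos u) auto
  also have "\<dots> \<le> (\<Sum>j\<in>UNIV. (?g j - T j) * x $ j + T j * (x $ j - u $ j))"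
  proof (rule sum_mono)
    fix j
    have "0 \<le> (?g j - T j) * u $ j"
      using u by (intro mult_nonneg_nonneg) (auto simp: T_def)
    then show "?g j * (x $ j - u $ j) \<le> (?g j - T j) * x $ j + T j * (x $ j - u $ j)"
      by (simp add: algebra_simps)
  qed
  finally have "?\<gamma> * (f_alpha A \<alpha> x - f_alpha A \<alpha> u) \<le>
      ?\<gamma> * (\<Sum>j\<in>UNIV. (?g j - T j) * x $ j + T j * (x $ j - u $ j))"
    using \<eta> by (intro mult_left_mono) auto
  also have "\<dots> = ?\<gamma> * (\<Sum>j\<in>UNIV. (?g j - T j) * x $ j) + \<eta> * (\<Sum>j\<in>UNIV. (x $ j - u $ j) * (\<alpha>\<^sup>2 / 4 * T j))"
    by (simp add: sum.distrib distrib_left sum_distrib_left mult_ac)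
  also have "(\<Sum>j\<in>UNIV. (x $ j - u $ j) * (\<alpha>\<^sup>2 / 4 * T j)) =
      (\<Sum>j\<in>UNIV. breg \<alpha> (u $ j) (x $ j) - breg \<alpha> (u $ j) (y $ j) + breg \<alpha> (x $ j) (y $ j))"
    using \<alpha> by (simp add: breg_three_point x_pos y_pos y_powr)
  finally have "?\<gamma> * (f_alpha A \<alpha> x - f_alpha A \<alpha> u) \<le>
      S + \<eta> * (\<Sum>j\<in>UNIV. breg \<alpha> (u $ j) (x $ j)) - \<eta> * (\<Sum>j\<in>UNIV. breg \<alpha> (u $ j) (y $ j))"
    by (simp add: S_def sum.distrib sum_subtractf algebra_simps)
  moreover have "(w + c) * fy + d \<le> w * fx + bx + c * fu"
    if "c * (fx - fu) \<le> S + bx - d" "S \<le> (w + c) * (fx - fy)" for c fx fy fu bx d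
    using that by (simp add: algebra_simps)
  ultimately show ?thesis
    using progress by blast
qed

end

section \<open>The run of the algorithm\<close>

locale packing_run =
  fixes A :: "real ^ 'n ^ 'm" and \<epsilon> OPT :: real
  assumes A_nonneg: "\<And>i j. 0 \<le> A $ i $ j"
    and A_ge_1: "\<And>i j. A $ i $ j \<noteq> 0 \<Longrightarrow> 1 \<le> A $ i $ j"
    and eps: "0 < \<epsilon>" "\<epsilon> \<le> 1 / 4"
    and opt: "is_packing_opt A OPT"
begin

abbreviation "\<alpha> \<equiv> alpha A \<epsilon>"
abbreviation "\<eta> \<equiv> eta \<epsilon>"
abbreviation "mx \<equiv> max_entry A"
abbreviation "M \<equiv> real CARD('m) * real CARD('n) * mx / \<epsilon>"

section \<open>The optimum and the parameters\<close>

text \<open>With a zero column, raising that variable keeps every point feasible and improves it, so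
  no maximum would be attained.\<close>

lemma A_column: "\<exists>i. A $ i $ j \<noteq> 0"
proof (rule ccontr)
  assume "\<nexists>i. A $ i $ j \<noteq> 0"
  then have z: "A *v axis j 1 = 0"
    by (simp add: matrix_vector_mult_basis column_def vec_eq_iff)
  obtain u where u: "packing_feasible A u" "1 \<bullet> u = OPT"
    using opt by (auto simp: is_packing_opt_def)
  have "A *v (u + axis j 1) = A *v u"
    by (simp add: matrix_vector_right_distrib z)
  with u have "packing_feasible A (u + axis j 1)"
    by (auto simp: packing_feasible_def less_eq_vec_def axis_def)
  then have "1 \<bullet> (u + axis j 1) \<le> OPT"
    using opt by (auto simp: is_packing_opt_def)
  then show False
    using u by (simp add: inner_add_right inner_axis)
qed

lemma A_le_mx: "A $ i $ j \<le> mx"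
  unfolding max_entry_def by (rule Max_ge) (auto intro!: image_eqI[of _ _ "(i, j)"])

lemma mx_ge_1: "1 \<le> mx"
proof -
  obtain i where "A $ i $ undefined \<noteq> 0"
    using A_column by blast
  then show ?thesis
    using A_ge_1 A_le_mx[of i undefined] by (meson order_trans)
qed

text \<open>The uniform point with coordinates \<open>1 / (n * mx)\<close>, \<open>n\<close> being
  the number of columns, is feasible and has value \<open>1 / mx\<close>.\<close>

lemma OPT_ge: "1 / mx \<le> OPT"
proof -
  define x :: "real ^ 'n" where "x = (\<chi> j. 1 / (real CARD('n) * mx))"
  have "(A *v x) $ i \<le> 1" for i
  proof -
    have "(A *v x) $ i \<le> (\<Sum>j\<in>(UNIV::'n set). mx * (1 / (real CARD('n) * mx)))"
      unfolding matrix_vector_mult_def vec_lambda_beta x_def using mx_ge_1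
      by (intro sum_mono mult_right_mono A_le_mx) auto
    then show ?thesis
      using mx_ge_1 by simp
  qed
  then have "packing_feasible A x"
    using mx_ge_1 by (auto simp: packing_feasible_def less_eq_vec_def x_def)
  then have "1 \<bullet> x \<le> OPT"
    using opt by (auto simp: is_packing_opt_def)
  then show ?thesis
    by (simp add: x_def inner_vec_def)
qed

lemma OPT_pos: "0 < OPT"
  using OPT_ge mx_ge_1 by (smt (verit) divide_pos_pos)

lemma M_ge: "4 \<le> M" "1 / \<epsilon> * (real CARD('n) * mx) \<le> M"
proof -
  have m: "1 \<le> real CARD('m)" and n: "1 \<le> real CARD('n)"
    by (simp_all add: Suc_le_eq)
  have "1 * (real CARD('n) * mx) \<le> real CARD('m) * (real CARD('n) * mx)"
    using m mx_ge_1 by (intro mult_right_mono) auto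
  then show *: "1 / \<epsilon> * (real CARD('n) * mx) \<le> M"
    using eps by (simp add: divide_right_mono mult.assoc)
  have "4 * (1 * 1) \<le> 1 / \<epsilon> * (real CARD('n) * mx)"
    using eps n mx_ge_1 by (intro mult_mono) (auto simp: field_simps)
  then show "4 \<le> M"
    using * by linarith
qed

lemma M_pos: "0 < M"
  using M_ge(1) by linarith

lemma ln_M: "1 \<le> ln M" "\<alpha> * ln M = \<epsilon> / 4" "\<alpha> * \<eta> = 1 / (4 * ln M)"
proof -
  show *: "1 \<le> ln M"
    using M_ge(1) exp_le by (subst ln_ge_iff) auto
  show "\<alpha> * ln M = \<epsilon> / 4" "\<alpha> * \<eta> = 1 / (4 * ln M)"
    using * eps by (auto simp: alpha_def eta_def)
qed

lemma \<alpha>\<eta>: "0 < \<alpha> * \<eta>" "\<alpha> * \<eta> \<le> 1 / 4"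
proof -
  have "0 < 1 / (4 * L) \<and> 1 / (4 * L) \<le> 1 / 4" if "1 \<le> L" for L :: real
    using that by simp
  from this[OF ln_M(1)] show "0 < \<alpha> * \<eta>" "\<alpha> * \<eta> \<le> 1 / 4"
    unfolding ln_M(3) by blast+
qed

lemma \<alpha>_bounds: "0 < \<alpha>" "\<alpha> \<le> \<epsilon> / 4" "\<alpha> \<le> 1 / 16"
  using \<alpha>\<eta> eps by (auto simp: eta_def field_simps)

lemma eta_pos: "0 < \<eta>"
  using eps by (simp add: eta_def)

lemma gamma_eq: "gamma A \<epsilon> = \<alpha>\<^sup>2 * \<eta> / 4"
  by (simp add: gamma_def)

lemma gamma_pos: "0 < gamma A \<epsilon>"
  using \<alpha>_bounds eps by (simp add: gamma_def eta_def)

lemma f_alpha_ge: "- (1 \<bullet> x) \<le> f_alpha A \<alpha> x"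
  using \<alpha>_bounds by (simp add: f_alpha_def sum_nonneg)

text \<open>The choice of \<open>\<alpha>\<close> makes \<open>exp (- \<epsilon> / (4 * \<alpha>))\<close> equal to \<open>1 / M\<close>, so slack
  \<open>\<epsilon> / 4\<close> in every row makes the penalty negligible.\<close>

lemma f_alpha_le:
  assumes x: "\<And>j. 0 \<le> x $ j" and Ax: "\<And>i. (A *v x) $ i \<le> 1 - \<epsilon> / 4"
  shows "f_alpha A \<alpha> x \<le> - (1 \<bullet> x) + \<epsilon> / 16 * (1 / mx)"
proof -
  have row: "(A *v x) $ i powr ((1 + \<alpha>) / \<alpha>) \<le> 1 / M" for i
  proof -
    have nn: "0 \<le> (A *v x) $ i"
      using A_nonneg x by (auto simp: matrix_vector_mult_def intro!: sum_nonneg)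
    have "(A *v x) $ i powr ((1 + \<alpha>) / \<alpha>) \<le> (1 - \<epsilon> / 4) powr ((1 + \<alpha>) / \<alpha>)"
      using Ax nn \<alpha>_bounds by (intro powr_mono2) auto
    also have "\<dots> \<le> (1 - \<epsilon> / 4) powr (1 / \<alpha>)"
      using eps \<alpha>_bounds by (intro powr_mono') (auto simp: field_simps)
    also have "\<dots> = exp (ln (1 - \<epsilon> / 4) / \<alpha>)"
      using eps by (simp add: powr_def)
    also have "\<dots> \<le> exp (- (\<epsilon> / 4) / \<alpha>)"
      using ln_add_one_self_le_self2[of "- (\<epsilon> / 4)"] eps \<alpha>_bounds
      unfolding exp_le_cancel_iff by (intro divide_right_mono) auto
    also have "- (\<epsilon> / 4) / \<alpha> = - ln M"
      using ln_M(2) \<alpha>_bounds by (simp add: field_simps)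
    also have "exp (- ln M) = 1 / M"
      using M_pos by (simp only: exp_minus exp_ln inverse_eq_divide)
    finally show ?thesis .
  qed
  have "(\<Sum>i\<in>UNIV. (A *v x) $ i powr ((1 + \<alpha>) / \<alpha>)) \<le> (\<Sum>i\<in>(UNIV::'m set). 1 / M)"
    by (intro sum_mono row)
  \<comment> \<open>The number of rows cancels against the factor \<open>CARD('m)\<close> of
    \<open>M\<close>.\<close>
  also have "\<dots> = \<epsilon> * (1 / (real CARD('n) * mx))"
    by simp
  also have "\<dots> \<le> \<epsilon> * (1 / (1 * mx))"
    using eps mx_ge_1
    by (intro mult_left_mono divide_left_mono mult_right_mono) (auto simp: Suc_le_eq)
  finally have "\<alpha> / (1 + \<alpha>) * (\<Sum>i\<in>UNIV. (A *v x) $ i powr ((1 + \<alpha>) / \<alpha>)) \<le> 1 / 16 * (\<epsilon> * (1 / (1 * mx)))"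
    using \<alpha>_bounds by (intro mult_mono sum_nonneg) (auto simp: field_simps)
  then show ?thesis
    by (simp add: f_alpha_def)
qed

section \<open>The starting point\<close>

lemma x_init_nth: "x_init A \<epsilon> $ j = (1 - \<epsilon>) / (real CARD('n) * mx)"
  by (simp add: x_init_def)

lemma x_init_pos: "0 < x_init A \<epsilon> $ j"
  unfolding x_init_nth using mx_ge_1 eps by (intro divide_pos_pos mult_pos_pos) auto

lemma x_init_le: "x_init A \<epsilon> $ j \<le> 1 / (real CARD('n) * mx)"
  unfolding x_init_nth using mx_ge_1 eps by (intro divide_right_mono) auto

text \<open>As \<open>\<epsilon> \<le> 1 - \<epsilon>\<close>, the start is at least
  \<open>1 / M\<close> in each coordinate, so the power is at most
  \<open>exp (\<alpha> * ln M) = exp (\<epsilon> / 4)\<close>. The constant is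
  \<open>1 / 4 + 1 / 64\<close>.\<close>

lemma x_init_powr: "x_init A \<epsilon> $ j powr (- \<alpha>) \<le> 1 + 17 / 64 * \<epsilon>"
proof -
  have "1 / M \<le> \<epsilon> / (real CARD('n) * mx)"
  proof -
    have "1 / M \<le> 1 / (1 / \<epsilon> * (real CARD('n) * mx))"
      using M_ge mx_ge_1 eps by (intro divide_left_mono mult_pos_pos) auto
    then show ?thesis by simp
  qed
  also have "\<dots> \<le> x_init A \<epsilon> $ j"
    unfolding x_init_nth using mx_ge_1 eps by (intro divide_right_mono) auto
  finally have "x_init A \<epsilon> $ j powr (- \<alpha>) \<le> (1 / M) powr (- \<alpha>)"
    using \<alpha>_bounds by (intro powr_mono2' divide_pos_pos M_pos) auto
  also have "\<dots> = exp (\<alpha> * ln M)"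
  proof -
    have "(1 / L) powr (- \<alpha>) = exp (\<alpha> * ln L)" if "0 < L" for L :: real
      using that by (simp add: powr_def ln_div)
    then show ?thesis
      using M_pos .
  qed
  also have "\<dots> = exp (\<epsilon> / 4)"
    unfolding ln_M(2) ..
  also have "\<dots> \<le> 1 + \<epsilon> / 4 + (\<epsilon> / 4)\<^sup>2"
    using eps by (intro exp_le_quadratic) auto
  also have "(\<epsilon> / 4)\<^sup>2 = \<epsilon> / 16 * \<epsilon>"
    by (simp add: power2_eq_square)
  also have "1 + \<epsilon> / 4 + \<epsilon> / 16 * \<epsilon> \<le> 1 + \<epsilon> / 4 + (1 / 4) / 16 * \<epsilon>"
    using eps by (intro add_left_mono mult_right_mono) auto
  finally show ?thesis
    by simp
qed

lemma Ax_init_le: "(A *v x_init A \<epsilon>) $ i \<le> 1 - \<epsilon>"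
proof -
  have "(A *v x_init A \<epsilon>) $ i \<le> (\<Sum>j\<in>(UNIV::'n set). mx * ((1 - \<epsilon>) / (real CARD('n) * mx)))"
    unfolding matrix_vector_mult_def vec_lambda_beta x_init_nth using mx_ge_1 eps
    by (intro sum_mono mult_right_mono A_le_mx) auto
  then show ?thesis
    using mx_ge_1 by simp
qed

lemma f_alpha_x_init: "f_alpha A \<alpha> (x_init A \<epsilon>) \<le> 0"
proof -
  have "(A *v x_init A \<epsilon>) $ i \<le> 1 - \<epsilon> / 4" for i
    using Ax_init_le[of i] eps by linarith
  then have "f_alpha A \<alpha> (x_init A \<epsilon>) \<le> - (1 \<bullet> x_init A \<epsilon>) + \<epsilon> / 16 * (1 / mx)"
    using x_init_pos by (intro f_alpha_le) (auto simp: less_imp_le)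
  also have "1 \<bullet> x_init A \<epsilon> = (1 - \<epsilon>) * (1 / mx)"
    by (simp add: x_init_nth inner_vec_def)
  also have "- ((1 - \<epsilon>) * (1 / mx)) + \<epsilon> / 16 * (1 / mx) = (\<epsilon> / 16 - (1 - \<epsilon>)) * (1 / mx)"
    unfolding left_diff_distrib by linarith
  also have "\<dots> \<le> 0"
    using eps mx_ge_1 by (intro mult_nonpos_nonneg) auto
  finally show ?thesis .
qed

text \<open>Since \<open>u $ j \<le> 1\<close>,
  \<open>u $ j powr (1 - \<alpha>) / (1 - \<alpha>)\<close> is at least \<open>u $ j\<close> and
  cancels the main part of \<open>u $ j * x powr (- \<alpha>)\<close>. What remains sums to at most
  \<open>(17 / 64 + 3 / 10) * \<epsilon> * OPT\<close>, and
  \<open>\<eta> = 1 / \<epsilon>\<close>.\<close>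

lemma breg_x_init_le:
  assumes u: "packing_feasible A u"
  shows "\<eta> * (\<Sum>j\<in>UNIV. breg \<alpha> (u $ j) (x_init A \<epsilon> $ j)) \<le> 3 / 5 * OPT"
proof -
  have u0: "0 \<le> u $ j" for j
    using u by (auto simp: packing_feasible_def less_eq_vec_def)
  have u1: "u $ j \<le> 1" for j
  proof -
    obtain i where "A $ i $ j \<noteq> 0"
      using A_column by blast
    then have "1 * u $ j \<le> A $ i $ j * u $ j"
      using A_ge_1 u0 by (intro mult_right_mono) auto
    also have "\<dots> \<le> (A *v u) $ i"
      using A_nonneg u0 unfolding matrix_vector_mult_def vec_lambda_beta
      by (intro member_le_sum) auto
    also have "\<dots> \<le> 1"
      using u by (auto simp: packing_feasible_def less_eq_vec_def)
    finally show ?thesis by simp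
  qed
  have coord: "breg \<alpha> (u $ j) (x_init A \<epsilon> $ j) \<le> 17 / 64 * \<epsilon> * u $ j + 3 / 10 * \<epsilon> * (1 / (real CARD('n) * mx))" for j
  proof -
    let ?x = "x_init A \<epsilon> $ j"
    have "u $ j * ?x powr (- \<alpha>) \<le> u $ j * (1 + 17 / 64 * \<epsilon>)"
      by (intro mult_left_mono x_init_powr u0)
    moreover have "u $ j \<le> u $ j powr (1 - \<alpha>) / (1 - \<alpha>)"
    proof -
      have "u $ j powr 1 \<le> u $ j powr (1 - \<alpha>)"
        using u0 u1 \<alpha>_bounds by (intro powr_mono') auto
      moreover have "u $ j powr (1 - \<alpha>) * (1 - \<alpha>) \<le> u $ j powr (1 - \<alpha>) * 1"
        using \<alpha>_bounds by (intro mult_left_mono) auto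
      then have "u $ j powr (1 - \<alpha>) \<le> u $ j powr (1 - \<alpha>) / (1 - \<alpha>)"
        using \<alpha>_bounds by (simp add: pos_le_divide_eq)
      ultimately show ?thesis
        using u0[of j] by simp
    qed
    moreover have "\<alpha> / (1 - \<alpha>) * ?x powr (1 - \<alpha>) \<le> 3 / 10 * \<epsilon> * (1 / (real CARD('n) * mx))"
    proof -
      have "\<alpha> / (1 - \<alpha>) \<le> (\<epsilon> / 4) / (1 - 1 / 16)"
        using \<alpha>_bounds eps by (intro frac_le) auto
      moreover have "?x powr (1 - \<alpha>) = ?x powr (- \<alpha>) * ?x"
        using x_init_pos[of j] by (simp add: powr_diff powr_minus_divide)
      moreover have "?x powr (- \<alpha>) * ?x \<le> (1 + 17 / 64 * (1 / 4)) * (1 / (real CARD('n) * mx))"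
        using x_init_powr[of j] x_init_le[of j] x_init_pos[of j] eps
        by (intro mult_mono) linarith+
      ultimately have "\<alpha> / (1 - \<alpha>) * ?x powr (1 - \<alpha>) \<le>
          (\<epsilon> / 4) / (1 - 1 / 16) * ((1 + 17 / 64 * (1 / 4)) * (1 / (real CARD('n) * mx)))"
        using \<alpha>_bounds eps x_init_pos[of j] by (intro mult_mono) auto
      also have "\<dots> = (1 / 4) / (1 - 1 / 16) * (1 + 17 / 64 * (1 / 4)) * (\<epsilon> * (1 / (real CARD('n) * mx)))"
        by simp
      also have "\<dots> \<le> 3 / 10 * (\<epsilon> * (1 / (real CARD('n) * mx)))"
        using eps mx_ge_1 by (intro mult_right_mono) auto
      finally show ?thesis by simp
    qed
    moreover have "u $ j * (1 + 17 / 64 * \<epsilon>) = u $ j + 17 / 64 * \<epsilon> * u $ j"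
      by (simp add: algebra_simps)
    ultimately show ?thesis
      unfolding breg_def by linarith
  qed
  have "(\<Sum>j\<in>UNIV. breg \<alpha> (u $ j) (x_init A \<epsilon> $ j)) \<le>
      (\<Sum>j\<in>UNIV. 17 / 64 * \<epsilon> * u $ j + 3 / 10 * \<epsilon> * (1 / (real CARD('n) * mx)))"
    by (intro sum_mono coord)
  also have "\<dots> = 17 / 64 * \<epsilon> * (1 \<bullet> u) + 3 / 10 * \<epsilon> * (1 / mx)"
    using mx_ge_1 by (simp add: sum.distrib sum_distrib_left inner_vec_def)
  also have "\<dots> \<le> 17 / 64 * \<epsilon> * OPT + 3 / 10 * \<epsilon> * OPT"
    using u opt OPT_ge eps by (intro add_mono mult_left_mono) (auto simp: is_packing_opt_def)
  also have "\<dots> \<le> \<epsilon> * (3 / 5 * OPT)"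
    using eps OPT_pos by (simp add: field_simps)
  finally have "(\<Sum>j\<in>UNIV. breg \<alpha> (u $ j) (x_init A \<epsilon> $ j)) \<le> \<epsilon> * (3 / 5 * OPT)" .
  then show ?thesis
    using eps unfolding eta_def by (simp add: pos_divide_le_eq mult.commute)
qed

section \<open>Invariants and accumulated regret\<close>

text \<open>Indices are shifted: \<open>x_iter\<close> at \<open>Suc k\<close> is computed from
  \<open>z_iter\<close> at \<open>k\<close> and paired with the weight \<open>A_iter\<close> at
  \<open>k\<close>. The upper bound lets the mirror variable drift by at most
  \<open>gamma / \<eta>\<close> per step.\<close>

definition valid_iterate :: "nat \<Rightarrow> bool" where
  "valid_iterate k \<longleftrightarrow>
     (\<forall>j. 0 < x_iter A \<epsilon> (Suc k) $ j \<and>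
       x_iter A \<epsilon> (Suc k) $ j powr (- \<alpha>) = 1 + z_iter A \<epsilon> k $ j / \<eta> \<and>
       x_iter A \<epsilon> (Suc k) $ j powr (- \<alpha>) \<le> 1 + 17 / 64 * \<epsilon> + (A_iter A \<epsilon> k - 1) / \<eta>) \<and>
     (\<forall>i. (A *v x_iter A \<epsilon> (Suc k)) $ i \<le> 1 + \<alpha>)"

text \<open>The first pass through the loop only inverts the mirror map at
  \<open>z_iter A \<epsilon> 0\<close> and so recovers the starting point.\<close>

lemma x_iter_1: "x_iter A \<epsilon> (Suc 0) = x_init A \<epsilon>"
proof -
  have "z_iter A \<epsilon> 0 = (\<chi> j. \<eta> * (- 1 + x_init A \<epsilon> $ j powr (- \<alpha>)))"
    using \<alpha>_bounds by (simp add: gradient_psi x_init_pos)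
  then show ?thesis
    using \<alpha>_bounds eps x_init_pos
    by (simp add: x_of_z_def vec_eq_iff eta_def powr_powr less_imp_le)
qed

lemma valid_iterate_0: "valid_iterate 0"
proof -
  have "z_iter A \<epsilon> 0 = (\<chi> j. \<eta> * (- 1 + x_init A \<epsilon> $ j powr (- \<alpha>)))"
    using \<alpha>_bounds by (simp add: gradient_psi x_init_pos)
  then have "x_init A \<epsilon> $ j powr (- \<alpha>) = 1 + z_iter A \<epsilon> 0 $ j / \<eta>" for j
    using eps by (simp add: eta_def)
  moreover have "(A *v x_init A \<epsilon>) $ i \<le> 1 + \<alpha>" for i
    using Ax_init_le[of i] eps \<alpha>_bounds by linarith
  ultimately show ?thesis
    using x_init_pos x_init_powr by (simp add: valid_iterate_def x_iter_1 del: x_iter.simps z_iter.simps)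
qed

text \<open>The loop guard caps the total drift of the mirror variable at 1, so it stays below
  \<open>2 + 17 / 256 < 25 / 12\<close>.\<close>

lemma packing_step_iterate:
  assumes k: "valid_iterate k" and w: "A_iter A \<epsilon> k \<le> \<eta>"
  shows "packing_step A (x_iter A \<epsilon> (Suc k)) \<alpha>"
proof
  fix j
  have "x_iter A \<epsilon> (Suc k) $ j powr (- \<alpha>) \<le> 1 + 17 / 64 * \<epsilon> + (A_iter A \<epsilon> k - 1) / \<eta>"
    using k unfolding valid_iterate_def by blast
  moreover have "(A_iter A \<epsilon> k - 1) / \<eta> \<le> 1"
    using w eta_pos by (simp add: divide_le_eq)
  ultimately show "x_iter A \<epsilon> (Suc k) $ j powr (- \<alpha>) \<le> 25 / 12"
    using eps by linarith
qed (use k A_nonneg A_ge_1 A_column \<alpha>_bounds in \<open>auto simp: valid_iterate_def simp del: x_iter.simps\<close>)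

lemma
  assumes k: "valid_iterate k" and w: "A_iter A \<epsilon> k \<le> \<eta>"
  shows valid_iterate_Suc: "valid_iterate (Suc k)"
    and x_iter_Suc: "x_iter A \<epsilon> (Suc (Suc k)) = packing_step.y A (x_iter A \<epsilon> (Suc k)) \<alpha>"
proof -
  interpret S: packing_step A "x_iter A \<epsilon> (Suc k)" \<alpha>
    by (rule packing_step_iterate[OF k w])
  have z: "1 + z_iter A \<epsilon> (Suc k) $ j / \<eta> = x_iter A \<epsilon> (Suc k) $ j powr (- \<alpha>) + \<alpha>\<^sup>2 / 4 * S.T j" for j
  proof -
    \<comment> \<open>The iterate is positive, so \<open>gradient\<close> is given by the closed
      form.\<close>
    have g: "gradient (f_alpha A \<alpha>) (x_iter A \<epsilon> (Suc k)) $ j = pgrad A \<alpha> (x_iter A \<epsilon> (Suc k)) j"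
      using gradient_f_alpha[OF A_nonneg S.x_pos S.\<alpha>(1)] by (simp add: pgrad_def del: x_iter.simps)
    have "trunc_gradient A \<alpha> (x_iter A \<epsilon> (Suc k)) $ j = S.T j"
      unfolding trunc_gradient_def vec_lambda_beta g S.T_def by (simp add: min_def)
    then have "1 + z_iter A \<epsilon> (Suc k) $ j / \<eta> = 1 + z_iter A \<epsilon> k $ j / \<eta> + gamma A \<epsilon> / \<eta> * S.T j"
      unfolding z_iter_Suc_x_iter by (simp add: add_divide_distrib del: x_iter.simps)
    also have "gamma A \<epsilon> / \<eta> = \<alpha>\<^sup>2 / 4"
      using eps by (simp add: gamma_def eta_def)
    finally show ?thesis
      using k by (auto simp: valid_iterate_def simp del: x_iter.simps z_iter.simps)
  qed
  show y: "x_iter A \<epsilon> (Suc (Suc k)) = S.y"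
    unfolding x_iter.simps(2)[of A \<epsilon> "Suc k"] x_of_z_def z S.y_def by simp
  have "x_iter A \<epsilon> (Suc (Suc k)) $ j powr (- \<alpha>) \<le> 1 + 17 / 64 * \<epsilon> + (A_iter A \<epsilon> (Suc k) - 1) / \<eta>" for j
  proof -
    have "x_iter A \<epsilon> (Suc (Suc k)) $ j powr (- \<alpha>) = x_iter A \<epsilon> (Suc k) $ j powr (- \<alpha>) + \<alpha>\<^sup>2 / 4 * S.T j"
      unfolding y by (rule S.y_powr)
    also have "\<dots> \<le> 1 + 17 / 64 * \<epsilon> + (A_iter A \<epsilon> k - 1) / \<eta> + \<alpha>\<^sup>2 / 4 * 1"
    proof (intro add_mono mult_left_mono)
      show "x_iter A \<epsilon> (Suc k) $ j powr (- \<alpha>) \<le> 1 + 17 / 64 * \<epsilon> + (A_iter A \<epsilon> k - 1) / \<eta>"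
        using k unfolding valid_iterate_def by blast
    qed (use S.abs_T_le[of j] in auto)
    also have "\<alpha>\<^sup>2 / 4 * 1 = gamma A \<epsilon> / \<eta>"
      using eps by (simp add: gamma_def eta_def)
    finally show ?thesis
      by (simp add: add_divide_distrib diff_divide_distrib del: x_iter.simps)
  qed
  then show "valid_iterate (Suc k)"
    unfolding valid_iterate_def using S.y_pos S.Ay_le S.y_powr z
    by (auto simp: y simp del: x_iter.simps z_iter.simps A_iter.simps)
qed

text \<open>Telescoping of \<open>regret_step\<close>, starting from equality at
  \<open>k = 0\<close>, where the weight is 1 and the iterate is \<open>x_init A \<epsilon>\<close>.
  Validity belongs to the same induction, since each step relies on it.\<close>

lemma regret_bound:
  assumes u: "\<And>j. 0 \<le> u $ j" and w: "A_iter A \<epsilon> k \<le> \<eta>"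
  shows "valid_iterate k \<and>
    A_iter A \<epsilon> k * f_alpha A \<alpha> (x_iter A \<epsilon> (Suc k)) + \<eta> * (\<Sum>j\<in>UNIV. breg \<alpha> (u $ j) (x_iter A \<epsilon> (Suc k) $ j))
    \<le> f_alpha A \<alpha> (x_init A \<epsilon>) + \<eta> * (\<Sum>j\<in>UNIV. breg \<alpha> (u $ j) (x_init A \<epsilon> $ j))
      + (A_iter A \<epsilon> k - 1) * f_alpha A \<alpha> u"
  using w
proof (induction k)
  case 0
  show ?case
    using valid_iterate_0 by (simp add: x_iter_1 del: x_iter.simps)
next
  case (Suc k)
  have w: "A_iter A \<epsilon> k \<le> \<eta>"
    using Suc.prems gamma_pos by simp
  note IH = Suc.IH[OF w]
  then have k: "valid_iterate k" by blast
  interpret S: packing_step A "x_iter A \<epsilon> (Suc k)" \<alpha>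
    by (rule packing_step_iterate[OF k w])
  have "1 \<le> A_iter A \<epsilon> k"
    using gamma_pos by (simp add: A_iter_eq)
  from S.regret_step[OF \<alpha>\<eta> u this]
  have "A_iter A \<epsilon> (Suc k) * f_alpha A \<alpha> S.y + \<eta> * (\<Sum>j\<in>UNIV. breg \<alpha> (u $ j) (S.y $ j))
    \<le> A_iter A \<epsilon> k * f_alpha A \<alpha> (x_iter A \<epsilon> (Suc k)) + \<eta> * (\<Sum>j\<in>UNIV. breg \<alpha> (u $ j) (x_iter A \<epsilon> (Suc k) $ j))
      + gamma A \<epsilon> * f_alpha A \<alpha> u"
    by (simp add: gamma_eq del: x_iter.simps)
  moreover have "(A_iter A \<epsilon> (Suc k) - 1) * f_alpha A \<alpha> u =
      (A_iter A \<epsilon> k - 1) * f_alpha A \<alpha> u + gamma A \<epsilon> * f_alpha A \<alpha> u"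
    by (simp add: algebra_simps)
  ultimately show ?case
    using IH valid_iterate_Suc[OF k w] unfolding x_iter_Suc[OF k w] by linarith
qed

section \<open>Feasibility and value of the output\<close>

lemma output_guarantee:
  "A *v packing_covering_lp A \<epsilon> \<le> (1 + \<epsilon>) *\<^sub>R 1 \<and> 1 \<bullet> packing_covering_lp A \<epsilon> \<ge> (1 - 3 * \<epsilon>) * OPT"
proof -
  have "A_iter A \<epsilon> (stop_iter A \<epsilon>) > \<eta>"
    using stop_iter_properties(1)[of \<epsilon> A] eps \<alpha>_bounds by simp
  moreover have "A_iter A \<epsilon> 0 \<le> \<eta>"
    using eps by (simp add: eta_def)
  \<comment> \<open>The loop runs at least once, and the output at \<open>Suc k\<close> is paired
    with \<open>A_iter\<close> at \<open>k\<close>, the last weight that does not exceed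
    \<open>\<eta>\<close>.\<close>
  ultimately obtain k where k: "stop_iter A \<epsilon> = Suc k"
    by (metis not_less old.nat.exhaust)
  define w where "w = A_iter A \<epsilon> k"
  define x where "x = x_iter A \<epsilon> (Suc k)"
  have w_le: "w \<le> \<eta>"
    using stop_iter_properties(2)[of \<epsilon> A k] eps \<alpha>_bounds k by (simp add: w_def)
  have w_ge: "\<eta> < w + gamma A \<epsilon>"
    using \<open>A_iter A \<epsilon> (stop_iter A \<epsilon>) > \<eta>\<close> by (simp add: k w_def)
  have w1: "1 \<le> w"
    using gamma_pos by (simp add: A_iter_eq w_def)
  obtain v where v: "packing_feasible A v" "1 \<bullet> v = OPT"
    using opt by (auto simp: is_packing_opt_def)
  \<comment> \<open>Shrinking an optimal point leaves the slack that \<open>f_alpha_le\<close>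
    needs; together with the penalty this costs \<open>1 / 4 + 1 / 16 = 5 / 16\<close> times
    \<open>\<epsilon> * OPT\<close>.\<close>
  define u where "u = (1 - \<epsilon> / 4) *\<^sub>R v"
  have v0: "0 \<le> v $ j" and Av: "(A *v v) $ i \<le> 1" for i j
    using v by (auto simp: packing_feasible_def less_eq_vec_def)
  have u0: "0 \<le> u $ j" for j
    using v0 eps by (simp add: u_def)
  have Au: "(A *v u) $ i \<le> 1 - \<epsilon> / 4" for i
    using mult_left_mono[OF Av, of "1 - \<epsilon> / 4" i] eps by (simp add: u_def matrix_vector_mult_scaleR)
  have u: "packing_feasible A u"
  proof -
    have "(A *v u) $ i \<le> 1" for i
      using Au[of i] eps by linarith
    then show ?thesis
      using u0 by (auto simp: packing_feasible_def less_eq_vec_def)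
  qed
  have fu: "f_alpha A \<alpha> u \<le> - (1 - 5 / 16 * \<epsilon>) * OPT"
  proof -
    have "f_alpha A \<alpha> u \<le> - (1 \<bullet> u) + \<epsilon> / 16 * (1 / mx)"
      by (intro f_alpha_le u0 Au)
    also have "\<dots> \<le> - (1 \<bullet> u) + \<epsilon> / 16 * OPT"
      using OPT_ge eps by (intro add_left_mono mult_left_mono) auto
    finally show ?thesis
      by (simp add: u_def v algebra_simps)
  qed
  have valid: "valid_iterate k"
    and regret: "w * f_alpha A \<alpha> x + \<eta> * (\<Sum>j\<in>UNIV. breg \<alpha> (u $ j) (x $ j))
    \<le> f_alpha A \<alpha> (x_init A \<epsilon>) + \<eta> * (\<Sum>j\<in>UNIV. breg \<alpha> (u $ j) (x_init A \<epsilon> $ j))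
      + (w - 1) * f_alpha A \<alpha> u"
    using regret_bound[OF u0, of k] w_le unfolding w_def x_def by auto
  have x_pos: "0 < x $ j" and Ax: "(A *v x) $ i \<le> 1 + \<alpha>" for i j
    using valid by (auto simp: valid_iterate_def x_def simp del: x_iter.simps)
  have "0 \<le> \<eta> * (\<Sum>j\<in>UNIV. breg \<alpha> (u $ j) (x $ j))"
    using eps \<alpha>_bounds u0 x_pos by (intro mult_nonneg_nonneg sum_nonneg breg_nonneg) (auto simp: eta_def)
  moreover have "w * - (1 \<bullet> x) \<le> w * f_alpha A \<alpha> x"
    using w1 f_alpha_ge by (intro mult_left_mono) auto
  moreover have "(w - 1) * f_alpha A \<alpha> u \<le> (w - 1) * (- (1 - 5 / 16 * \<epsilon>) * OPT)"
    using w1 fu by (intro mult_left_mono) auto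
  ultimately have "w * - (1 \<bullet> x) \<le> 3 / 5 * OPT + (w - 1) * (- (1 - 5 / 16 * \<epsilon>) * OPT)"
    using regret f_alpha_x_init breg_x_init_le[OF u] by linarith
  then have 1: "OPT * ((w - 1) * (1 - 5 / 16 * \<epsilon>) - 3 / 5) \<le> w * (1 \<bullet> x)"
    by (simp add: algebra_simps)
  have "\<epsilon> * \<eta> < \<epsilon> * (w + gamma A \<epsilon>)"
    using w_ge eps by (intro mult_strict_left_mono) auto
  then have "1 < \<epsilon> * w + \<alpha>\<^sup>2 / 4"
    using eps by (simp add: eta_def gamma_def distrib_left)
  moreover have "\<alpha>\<^sup>2 \<le> (1 / 16)\<^sup>2"
    using \<alpha>_bounds by (intro power_mono) auto
  \<comment> \<open>The last step overshoots little: \<open>\<epsilon> * gamma A \<epsilon> =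
    \<alpha>\<^sup>2 / 4 \<le> 1 / 1024\<close>.\<close>
  ultimately have "99 / 100 \<le> \<epsilon> * w"
    by (simp add: power2_eq_square)
  moreover define p where "p = \<epsilon> * w"
  moreover have "w * (1 - 3 * \<epsilon>) = w - 3 * p"
    "(w - 1) * (1 - 5 / 16 * \<epsilon>) = w - 5 / 16 * p - 1 + 5 / 16 * \<epsilon>"
    by (simp_all add: p_def field_simps)
  \<comment> \<open>The right side exceeds the left by
    \<open>43 / 16 * p - 8 / 5 + 5 / 16 * \<epsilon>\<close>, which is positive for
    \<open>p \<ge> 99 / 100\<close>.\<close>
  ultimately have "w * (1 - 3 * \<epsilon>) \<le> (w - 1) * (1 - 5 / 16 * \<epsilon>) - 3 / 5"
    using eps by simp
  then have "OPT * (w * (1 - 3 * \<epsilon>)) \<le> w * (1 \<bullet> x)"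
    using 1 OPT_pos mult_left_mono[of _ _ OPT] by (meson less_imp_le order_trans)
  then have "w * ((1 - 3 * \<epsilon>) * OPT) \<le> w * (1 \<bullet> x)"
    by (simp add: mult_ac)
  then have "(1 - 3 * \<epsilon>) * OPT \<le> 1 \<bullet> x"
    using w1 by simp
  moreover have "(A *v x) $ i \<le> 1 + \<epsilon>" for i
    using Ax[of i] \<alpha>_bounds eps by linarith
  ultimately show ?thesis
    unfolding packing_covering_lp_def k x_def[symmetric] by (simp add: less_eq_vec_def)
qed

end

theorem theorem1:
  fixes A :: "real ^ 'n ^ 'm" and \<epsilon> OPT :: real
  assumes nonneg: "\<And>i j. A $ i $ j \<ge> 0"
    and min_nonzero_attained: "\<exists>i j. A $ i $ j = 1"
    and min_nonzero_le: "\<And>i j. A $ i $ j \<noteq> 0 \<Longrightarrow> 1 \<le> A $ i $ j"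
    and eps: "0 < \<epsilon>" "\<epsilon> \<le> 1 / 4"
    and opt: "is_packing_opt A OPT"
  shows "A *v packing_covering_lp A \<epsilon> \<le> (1 + \<epsilon>) *\<^sub>R 1
    \<and> 1 \<bullet> packing_covering_lp A \<epsilon> \<ge> (1 - 3 * \<epsilon>) * OPT"
proof -
  interpret packing_run A \<epsilon> OPT
    by unfold_locales (fact nonneg min_nonzero_le eps opt)+
  show ?thesis
    by (rule output_guarantee)
qed

end
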